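(* Let $T>0$, $K\in\mathbb R$, and let $W$ be a one-dimensional Brownian motion starting at $x\in\mathbb R$ on $(\Omega,\mathscr F,\mathbb P)$. The Brownian indicator has chaos expansion $$F:=\mathbb I_{[K,\infty)}(W_T)=\sum_{n=0}^\infty J_n(g_n),$$ where $J_0(g_0)=g_0=\mathbb E F=\mathbb P[W_T>K]$ and $$g_n(t_1,\dots,t_n)=p_2^{(n-1)}(T,x-K)=\partial_2^{n-1}p(T,x-K)$$ for all $(t_1,\dots,t_n)$ with $0<t_1\le t_2\le\dots\le t_n<T$ and all $n\ge1$.
   Context: $p(t,x)=\frac1{\sqrt{2\pi t}}e^{-x^2/(2t)}$, and $p_2^{(m)}(t,x)=\partial_2^mp(t,x)$ is its $m$-th partial derivative in the second variable ($\partial_2^0p=p$). For deterministic $g_n\in L^2(S_n)$, $S_n=\{0\le t_1\le\dots\le t_n\le T\}$, $J_n(g_n)=\int_0^T\int_0^{t_n}\cdots\int_0^{t_2}g_n(t_1,\dots,t_n)\,dW_{t_1}\cdots dW_{t_n}$ is the $n$-fold iterated Itô–Wiener integral, and $J_0$ is the identity on constants. A chaos expansion is an $L^2(\Omega,\mathbb P)$-convergent expansion $F=\sum_nJ_n(g_n)$ with deterministic kernels. *)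

theory Defs
  imports "HOL-Probability.Probability"
begin

definition square_integrable :: "'a measure \<Rightarrow> ('a \<Rightarrow> real) \<Rightarrow> bool" where
  "square_integrable M f \<longleftrightarrow> f \<in> borel_measurable M \<and> integrable M (\<lambda>\<omega>. (f \<omega>)\<^sup>2)"

definition L2_tendsto :: "'a measure \<Rightarrow> (nat \<Rightarrow> 'a \<Rightarrow> real) \<Rightarrow> ('a \<Rightarrow> real) \<Rightarrow> bool" where
  "L2_tendsto M X Y \<longleftrightarrow>
     (\<forall>k. square_integrable M (X k)) \<and> square_integrable M Y \<and>
     (\<lambda>k. \<integral>\<omega>. (X k \<omega> - Y \<omega>)\<^sup>2 \<partial>M) \<longlonglongrightarrow> 0"

definition gauss_kernel :: "real \<Rightarrow> real \<Rightarrow> real" where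
  "gauss_kernel t y = 1 / sqrt (2 * pi * t) * exp (- y\<^sup>2 / (2 * t))"

definition gauss_kernel_deriv :: "nat \<Rightarrow> real \<Rightarrow> real \<Rightarrow> real" where
  "gauss_kernel_deriv m t y = (deriv ^^ m) (gauss_kernel t) y"

text \<open>Only the restriction of \<open>W\<close> to times \<open>t \<ge> 0\<close> matters.\<close>

definition brownian_motion :: "'a measure \<Rightarrow> real \<Rightarrow> (real \<Rightarrow> 'a \<Rightarrow> real) \<Rightarrow> bool" where
  "brownian_motion M x W \<longleftrightarrow>
     prob_space M \<and>
     (\<forall>t\<ge>0. W t \<in> borel_measurable M) \<and>
     (AE \<omega> in M. W 0 \<omega> = x) \<and>
     (\<forall>s t. 0 \<le> s \<longrightarrow> s < t \<longrightarrow>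
        distributed M lborel (\<lambda>\<omega>. W t \<omega> - W s \<omega>)
          (\<lambda>y. ennreal (normal_density 0 (sqrt (t - s)) y))) \<and>
     (\<forall>n (\<tau> :: nat \<Rightarrow> real). 0 \<le> \<tau> 0 \<longrightarrow> (\<forall>i<n. \<tau> i < \<tau> (Suc i)) \<longrightarrow>
        prob_space.indep_vars M (\<lambda>_. borel)
          (\<lambda>i \<omega>. W (\<tau> (Suc i)) \<omega> - W (\<tau> i) \<omega>) {..<n}) \<and>
     (AE \<omega> in M. continuous_on {0..} (\<lambda>t. W t \<omega>))"

definition natural_filtration ::
  "'a measure \<Rightarrow> (real \<Rightarrow> 'a \<Rightarrow> real) \<Rightarrow> real \<Rightarrow> 'a measure" where
  "natural_filtration M W t =
     sigma (space M) {W s -` A \<inter> space M | s A. s \<in> {0..t} \<and> A \<in> sets borel}"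

text \<open>
  A triple \<open>m\<close>, \<open>\<tau>\<close>, \<open>e\<close> encodes the elementary integrand taking the value \<open>e i\<close> on the
  time interval \<open>{\<tau> i<..\<tau> (Suc i)}\<close> for \<open>i < m\<close>, and \<open>0\<close> elsewhere.
\<close>

definition elementary_integrand ::
  "'a measure \<Rightarrow> (real \<Rightarrow> 'a \<Rightarrow> real) \<Rightarrow> real \<Rightarrow>
   nat \<Rightarrow> (nat \<Rightarrow> real) \<Rightarrow> (nat \<Rightarrow> 'a \<Rightarrow> real) \<Rightarrow> bool" where
  "elementary_integrand M W T m \<tau> e \<longleftrightarrow>
     (\<forall>i\<le>m. \<tau> i \<in> {0..T}) \<and> (\<forall>i<m. \<tau> i \<le> \<tau> (Suc i)) \<and>
     (\<forall>i<m. e i \<in> borel_measurable (natural_filtration M W (\<tau> i)) \<and>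
            square_integrable M (e i))"

definition elementary_process ::
  "nat \<Rightarrow> (nat \<Rightarrow> real) \<Rightarrow> (nat \<Rightarrow> 'a \<Rightarrow> real) \<Rightarrow> real \<Rightarrow> 'a \<Rightarrow> real" where
  "elementary_process m \<tau> e t \<omega> = (\<Sum>i<m. e i \<omega> * indicator {\<tau> i<..\<tau> (Suc i)} t)"

definition elementary_integral ::
  "(real \<Rightarrow> 'a \<Rightarrow> real) \<Rightarrow> nat \<Rightarrow> (nat \<Rightarrow> real) \<Rightarrow> (nat \<Rightarrow> 'a \<Rightarrow> real) \<Rightarrow> 'a \<Rightarrow> real" where
  "elementary_integral W m \<tau> e \<omega> = (\<Sum>i<m. e i \<omega> * (W (\<tau> (Suc i)) \<omega> - W (\<tau> i) \<omega>))"

text \<open>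
  \<open>has_ito_integral M W T H I\<close>: the random variable \<open>I\<close> is a version of \<open>\<integral>\<^sub>0\<^sup>T H\<^sub>t dW\<^sub>t\<close>,
  the \<open>L\<^sup>2\<close> limit of the integrals of adapted elementary processes converging to \<open>H\<close> in
  \<open>L\<^sup>2([0,T] \<times> \<Omega>)\<close>.  It is a relation because the integral is only determined up to null
  sets.  Approximability by elementary processes replaces an adaptedness condition on \<open>H\<close>;
  it forces \<open>H\<close> to agree almost everywhere with an adapted process.
\<close>

definition has_ito_integral ::
  "'a measure \<Rightarrow> (real \<Rightarrow> 'a \<Rightarrow> real) \<Rightarrow> real \<Rightarrow> (real \<Rightarrow> 'a \<Rightarrow> real) \<Rightarrow> ('a \<Rightarrow> real) \<Rightarrow> bool" where
  "has_ito_integral M W T H I \<longleftrightarrow>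
     (\<exists>m \<tau> e.
        (\<forall>k. elementary_integrand M W T (m k) (\<tau> k) (e k)) \<and>
        L2_tendsto (restrict_space lborel {0..T} \<Otimes>\<^sub>M M)
          (\<lambda>k (t, \<omega>). elementary_process (m k) (\<tau> k) (e k) t \<omega>) (\<lambda>(t, \<omega>). H t \<omega>) \<and>
        L2_tendsto M (\<lambda>k. elementary_integral W (m k) (\<tau> k) (e k)) I)"

text \<open>
  A kernel of \<open>n\<close> time variables is a function of \<open>t \<in> {1..n} \<rightarrow>\<^sub>E \<real>\<close>; for \<open>n = 0\<close> the only
  argument is \<open>\<lambda>_. undefined\<close>.
\<close>

definition time_simplex :: "nat \<Rightarrow> real \<Rightarrow> (nat \<Rightarrow> real) set" where
  "time_simplex n T = {t \<in> {1..n} \<rightarrow>\<^sub>E {0..T}. mono_on {1..n} t}"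

definition L2_kernel :: "nat \<Rightarrow> real \<Rightarrow> ((nat \<Rightarrow> real) \<Rightarrow> real) \<Rightarrow> bool" where
  "L2_kernel n T g \<longleftrightarrow>
     square_integrable (restrict_space (\<Pi>\<^sub>M i\<in>{1..n}. lborel) (time_simplex n T)) g"

text \<open>
  \<open>has_iterated_ito_integral M W n T g Z\<close>: the random variable \<open>Z\<close> is a version of
  \<open>\<integral>\<^sub>0\<^sup>T \<integral>\<^sub>0\<^bsup>t n\<^esup> \<dots> \<integral>\<^sub>0\<^bsup>t 2\<^esup> g t dW\<^bsub>t 1\<^esub> \<dots> dW\<^bsub>t n\<^esub>\<close>.  In the recursion, \<open>Y s\<close> is a version of the
  inner \<open>n\<close>-fold integral up to time \<open>s\<close>, where \<open>s\<close> is the value of the last time variable.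
\<close>

primrec has_iterated_ito_integral ::
  "'a measure \<Rightarrow> (real \<Rightarrow> 'a \<Rightarrow> real) \<Rightarrow> nat \<Rightarrow> real \<Rightarrow> ((nat \<Rightarrow> real) \<Rightarrow> real) \<Rightarrow>
   ('a \<Rightarrow> real) \<Rightarrow> bool" where
  "has_iterated_ito_integral M W 0 T g Z \<longleftrightarrow>
     Z \<in> borel_measurable M \<and> (AE \<omega> in M. Z \<omega> = g (\<lambda>_. undefined))"
| "has_iterated_ito_integral M W (Suc n) T g Z \<longleftrightarrow>
     (\<exists>Y. (AE s in restrict_space lborel {0..T}.
             has_iterated_ito_integral M W n s (\<lambda>t. g (t(Suc n := s))) (Y s)) \<and>
          has_ito_integral M W T Y Z)"

definition has_chaos_expansion ::
  "'a measure \<Rightarrow> (real \<Rightarrow> 'a \<Rightarrow> real) \<Rightarrow> real \<Rightarrow> ('a \<Rightarrow> real) \<Rightarrow>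
   (nat \<Rightarrow> (nat \<Rightarrow> real) \<Rightarrow> real) \<Rightarrow> bool" where
  "has_chaos_expansion M W T F g \<longleftrightarrow>
     (\<forall>n. L2_kernel n T (g n)) \<and>
     (\<exists>Z. (\<forall>n. has_iterated_ito_integral M W n T (g n) (Z n)) \<and>
          L2_tendsto M (\<lambda>N \<omega>. \<Sum>n<N. Z n \<omega>) F)"

end

theory Submission
  imports Defs "HOL-Computational_Algebra.Polynomial"
    "HOL-Computational_Algebra.Formal_Power_Series" "HOL-Real_Asymp.Real_Asymp"
begin

text \<open>
  Write \<open>B\<^sub>t = W\<^sub>t - x\<close>, and let \<open>h\<^sub>n(t, y)\<close> be the Hermite polynomials with variance parameter,
  i.e. the coefficients in \<open>exp (\<lambda> y - \<lambda>\<^sup>2 t / 2) = (\<Sum>n. \<lambda>\<^sup>n h\<^sub>n(t, y))\<close>.  Ito's formula gives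
  \<open>d h\<^sub>n\<^sub>+\<^sub>1(t, B\<^sub>t) = h\<^sub>n(t, B\<^sub>t) dB\<^sub>t\<close>, so the \<open>n\<close>-fold iterated integral of a constant \<open>c\<close> is
  \<open>c h\<^sub>n(T, B\<^sub>T)\<close> (lemma \<open>has_iterated_ito_integral_const\<close>).  A chaos expansion of a function
  of \<open>B\<^sub>T\<close> with constant kernels is therefore the same thing as its expansion in the orthogonal
  polynomials of the Gaussian law of \<open>B\<^sub>T\<close>, and three facts remain.

  \<^item> \<^emph>\<open>The integral formula.\<close>  The discrete counterpart of Ito's formula is the addition
    formula \<open>h\<^sub>n(s + d, y + z) = (\<Sum>j\<le>n. h\<^sub>n\<^sub>-\<^sub>j(s, y) h\<^sub>j(d, z))\<close>, which expands the increment of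
    \<open>h\<^sub>n\<^sub>+\<^sub>1(t, B\<^sub>t)\<close> over a step of length \<open>d\<close>.  The summands \<open>j = 0, 1\<close> are the old value and the
    summand of the elementary integral; those with \<open>j \<ge> 2\<close> are centred given the past and have
    variance \<open>O(d\<^sup>2)\<close>.  The errors of the \<open>T / d\<close> steps are orthogonal, so the total error has
    variance \<open>O(d)\<close> (lemma \<open>hermite_riemann_error\<close>).

  \<^item> \<^emph>\<open>The coefficients.\<close>  For \<open>n \<ge> 1\<close>, the coefficient of \<open>h\<^sub>n\<close> is \<open>n! / T\<^sup>n\<close> times the integral of
    \<open>h\<^sub>n(T, \<cdot>) p(T, \<cdot>)\<close> over the half line from \<open>a = K - x\<close>.  Since the derivative of
    \<open>h\<^sub>n\<^sub>-\<^sub>1 p\<close> is \<open>- (n / T) h\<^sub>n p\<close>, that integral is \<open>(T / n) h\<^sub>n\<^sub>-\<^sub>1(T, a) p(T, a)\<close>, and by the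
    Rodrigues formula (lemma \<open>rodrigues_hermite\<close>) the coefficient is the \<open>(n - 1)\<close>-st
    derivative of \<open>p(T, \<cdot>)\<close> at \<open>- a = x - K\<close>.

  \<^item> \<^emph>\<open>Convergence.\<close>  The partial sums are orthogonal projections onto the polynomials of
    bounded degree, so it suffices that the indicator of a half line is a limit of polynomials
    in Gaussian \<open>L\<^sup>2\<close>.  The sine integral \<open>Si\<close> does this explicitly: \<open>1/2 + Si (k (y - a)) / \<pi>\<close>
    is bounded and tends to the indicator of \<open>y \<ge> a\<close> except at \<open>y = a\<close> as \<open>k\<close> grows, and \<open>Si\<close> is entire of
    exponential type, so that its Taylor polynomials converge in Gaussian \<open>L\<^sup>2\<close> (lemma
    \<open>poly_approx_indicator_gauss_L2\<close>).
\<close>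

section \<open>Hermite polynomials with a variance parameter\<close>

text \<open>
  In terms of the usual monic polynomials \<open>He\<^sub>n\<close>, the value at \<open>y\<close> is
  \<open>t\<^sup>n\<^sup>/\<^sup>2 He\<^sub>n(y / \<surd>t) / n!\<close> for \<open>t > 0\<close>; the recursion also makes sense at \<open>t = 0\<close>, where it gives
  \<open>y\<^sup>n / n!\<close>.
\<close>
fun hermite :: "nat \<Rightarrow> real \<Rightarrow> real poly" where
  "hermite 0 t = 1"
| "hermite (Suc 0) t = [:0, 1:]"
| "hermite (Suc (Suc n)) t =
     smult (1 / real (n + 2)) ([:0, 1:] * hermite (Suc n) t - smult t (hermite n t))"

lemma hermite_rec:
  "real (n + 1) * poly (hermite (Suc n) t) y =
     y * poly (hermite n t) y - (if n = 0 then 0 else t * poly (hermite (n - 1) t) y)"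
  by (cases n) (simp_all add: field_simps)

lemma pderiv_hermite: "pderiv (hermite (Suc n) t) = hermite n t"
proof (induction n t rule: hermite.induct)
  case (3 n t)
  define h where "h = hermite (Suc (Suc n)) t"
  have h: "[:0, 1:] * hermite (Suc n) t - smult t (hermite n t) = smult (real (n + 2)) h"
    by (simp add: h_def)
  have "pderiv (hermite (Suc (Suc (Suc n))) t) =
     smult (1 / real (n + 3)) (pderiv ([:0, 1:] * h - smult t (hermite (Suc n) t)))"
    by (subst hermite.simps(3)) (simp only: pderiv_smult h_def, simp add: add.commute)
  also have "pderiv ([:0, 1:] * h - smult t (hermite (Suc n) t)) =
      h + ([:0, 1:] * hermite (Suc n) t - smult t (hermite n t))"
    unfolding pderiv_diff pderiv_mult pderiv_smult h_def 3 by (simp add: pderiv_pCons)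
  also have "\<dots> = smult (1 + real (n + 2)) h"
    unfolding h smult_add_left by simp
  also have "smult (1 / real (n + 3)) (smult (1 + real (n + 2)) h) = h"
    by (simp add: add.commute)
  finally show ?case by (simp only: h_def)
qed (simp_all add: pderiv_pCons pderiv_smult pderiv_diff pderiv_mult pderiv_1)

text \<open>
  The two terms on the right are the ones exchanged by Gaussian integration by parts.
\<close>
lemma hermite_Suc_conv_pderiv:
  "real (n + 1) * poly (hermite (Suc n) t) y = y * poly (hermite n t) y - t * poly (pderiv (hermite n t)) y"
  using hermite_rec[of n t y] by (cases n) (simp_all add: pderiv_hermite pderiv_1)

lemma fps_linear_ode_unique:
  fixes A B C :: "real fps"
  assumes "fps_deriv A = C * A" "fps_deriv B = C * B" "fps_nth A 0 = fps_nth B 0"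
  shows "A = B"
proof -
  have "fps_nth A n = fps_nth B n" for n
  proof (induction n rule: less_induct)
    case (less n)
    show ?case
    proof (cases n)
      case (Suc m)
      have step: "real (Suc m) * fps_nth D (Suc m) = (\<Sum>i=0..m. fps_nth C i * fps_nth D (m - i))"
        if "fps_deriv D = C * D" for D
        using arg_cong[OF that, of "\<lambda>f. fps_nth f m"] by (simp add: fps_mult_nth)
      have "real (Suc m) * fps_nth A (Suc m) = real (Suc m) * fps_nth B (Suc m)"
        unfolding step[OF assms(1)] step[OF assms(2)]
        by (intro sum.cong refl arg_cong2[where f="(*)"] less) (simp add: Suc)
      then show ?thesis using Suc by simp
    qed (use assms in simp)
  qed
  then show ?thesis by (simp add: fps_eq_iff)
qed

text \<open>
  The three-term recursion is the differential equation \<open>G' = (y - t X) G\<close> of the generating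
  function \<open>G = exp (y X - t X\<^sup>2 / 2)\<close>.
\<close>
lemma hermite_fps_deriv:
  "fps_deriv (Abs_fps (\<lambda>n. poly (hermite n t) y)) =
     (fps_const y - fps_const t * fps_X) * Abs_fps (\<lambda>n. poly (hermite n t) y)" (is "?l = ?r")
proof (rule fps_ext)
  fix n
  have "fps_nth ?l n = real (n + 1) * poly (hermite (Suc n) t) y"
    by simp
  also have "\<dots> = fps_nth ?r n"
    unfolding hermite_rec by (cases n) (simp_all add: left_diff_distrib mult.assoc)
  finally show "fps_nth ?l n = fps_nth ?r n" .
qed

text \<open>
  The parameters \<open>t\<close> and \<open>y\<close> enter the differential equation of the generating function linearly,
  so the product of two generating functions is the one for the sums of the parameters.
\<close>
lemma hermite_add:
  "poly (hermite n (s + d)) (y + z) =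
     (\<Sum>j\<le>n. poly (hermite (n - j) s) y * poly (hermite j d) z)"
proof -
  define G where "G t y = Abs_fps (\<lambda>n. poly (hermite n t) y)" for t y
  have "G (s + d) (y + z) = G s y * G d z"
  proof (rule fps_linear_ode_unique)
    show "fps_deriv (G (s + d) (y + z)) =
      (fps_const (y + z) - fps_const (s + d) * fps_X) * G (s + d) (y + z)"
      unfolding G_def by (rule hermite_fps_deriv)
    have d: "fps_deriv (G t u) = (fps_const u - fps_const t * fps_X) * G t u" for t u
      unfolding G_def by (rule hermite_fps_deriv)
    show "fps_deriv (G s y * G d z) = (fps_const (y + z) - fps_const (s + d) * fps_X) * (G s y * G d z)"
      unfolding fps_deriv_mult d
      by (simp add: algebra_simps flip: fps_const_add)
  qed (simp add: G_def)
  from arg_cong[OF this, of "\<lambda>f. fps_nth f n"] have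
    "poly (hermite n (s + d)) (y + z) = (\<Sum>j=0..n. poly (hermite j s) y * poly (hermite (n - j) d) z)"
    by (simp add: G_def fps_mult_nth)
  also have "\<dots> = (\<Sum>j\<le>n. poly (hermite (n - j) s) y * poly (hermite j d) z)"
    by (rule sum.reindex_bij_witness[of _ "\<lambda>j. n - j" "\<lambda>j. n - j"]) auto
  finally show ?thesis .
qed

lemma hermite_minus: "poly (hermite n t) (- y) = (-1) ^ n * poly (hermite n t) y"
  by (induction n t rule: hermite.induct) (simp_all add: field_simps)

lemma hermite_coeff: "degree (hermite n t) \<le> n \<and> coeff (hermite n t) n = 1 / fact n"
proof (induction n t rule: hermite.induct)
  case (3 n t)
  have deg: "degree ([:0, 1:] * hermite (Suc n) t) \<le> Suc (Suc n)"
    using 3 by (simp add: degree_pCons_eq_if)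
  have "degree (smult t (hermite n t)) \<le> Suc (Suc n)"
    using 3 degree_smult_le[of t "hermite n t"] by linarith
  with deg have "degree ([:0, 1:] * hermite (Suc n) t - smult t (hermite n t)) \<le> Suc (Suc n)"
    by (intro degree_diff_le)
  then have "degree (hermite (Suc (Suc n)) t) \<le> Suc (Suc n)"
    using degree_smult_le order_trans by (auto simp del: mult_pCons_left)
  moreover have "coeff (hermite n t) (Suc (Suc n)) = 0"
    using 3 by (intro coeff_eq_0) linarith
  ultimately show ?case using 3 by (simp add: field_simps)
qed simp_all

text \<open>
  As \<open>hermite n t\<close> has exact degree \<open>n\<close>, one can remove leading coefficients one after the other.
\<close>
lemma poly_eq_sum_hermite:
  assumes "degree p < N"
  shows "\<exists>b. \<forall>y. poly p y = (\<Sum>n<N. b n * poly (hermite n t) y)"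
proof -
  have "(\<forall>i\<ge>N. coeff p i = 0) \<Longrightarrow> \<exists>b. \<forall>y. poly p y = (\<Sum>n<N. b n * poly (hermite n t) y)"
  proof (induction N arbitrary: p)
    case 0
    then have "p = 0" by (intro poly_eqI) simp
    then show ?case by simp
  next
    case (Suc N)
    define q where "q = p - smult (coeff p N * fact N) (hermite N t)"
    have "coeff q i = 0" if "i \<ge> N" for i
      using that Suc.prems hermite_coeff[of N t] coeff_eq_0[of "hermite N t" i]
      by (cases "i = N") (auto simp: q_def)
    with Suc.IH obtain b where b: "\<And>y. poly q y = (\<Sum>n<N. b n * poly (hermite n t) y)" by blast
    have "poly p y = (\<Sum>n<Suc N. (b(N := coeff p N * fact N)) n * poly (hermite n t) y)" for y
      using b[of y] by (simp add: q_def)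
    then show ?case by blast
  qed
  then show ?thesis using assms by (auto simp: coeff_eq_0)
qed

lemma hermite_measurable[measurable]:
  "(\<lambda>(t, y). poly (hermite n t) y) \<in> borel_measurable (borel \<Otimes>\<^sub>M borel)"
proof -
  have "(\<lambda>z. poly (hermite n (fst z)) (snd z)) \<in> borel_measurable (borel \<Otimes>\<^sub>M borel)" for n
    by (induction n "0::real" rule: hermite.induct) simp_all
  then show ?thesis by (simp add: case_prod_beta')
qed

lemma poly_measurable[measurable]: "poly (p :: real poly) \<in> borel_measurable borel"
  by (intro borel_measurable_continuous_onI continuous_intros)

section \<open>Gaussian integrals of Hermite polynomials\<close>
lemma gauss_kernel_eq_normal_density: "0 < t \<Longrightarrow> gauss_kernel t = normal_density 0 (sqrt t)"
  by (auto simp: gauss_kernel_def normal_density_def fun_eq_iff)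

lemma gauss_kernel_measurable[measurable]: "gauss_kernel t \<in> borel_measurable borel"
  unfolding gauss_kernel_def[abs_def] by measurable

lemma gauss_kernel_nonneg: "0 < t \<Longrightarrow> 0 \<le> gauss_kernel t y"
  by (simp add: gauss_kernel_def)

lemma gauss_kernel_minus: "gauss_kernel t (- y) = gauss_kernel t y"
  by (simp add: gauss_kernel_def)

lemma gauss_kernel_has_derivative:
  "0 < t \<Longrightarrow> (gauss_kernel t has_real_derivative - (y / t) * gauss_kernel t y) (at y)"
  unfolding gauss_kernel_def[abs_def]
  by (auto intro!: derivative_eq_intros simp: field_simps)

lemma poly_gauss_kernel_has_derivative:
  assumes "0 < t"
  shows "((\<lambda>y. poly p y * gauss_kernel t y) has_real_derivative
    gauss_kernel t y * (poly (pderiv p) y - y / t * poly p y)) (at y)"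
  using DERIV_mult[OF poly_DERIV[of p y] gauss_kernel_has_derivative[OF assms, of y]]
  by (simp add: algebra_simps)

text \<open>
  Rodrigues formula: differentiating \<open>hermite n t\<close> times the kernel produces, by
  \<open>hermite_Suc_conv_pderiv\<close>, the factor \<open>- (n + 1) / t\<close> and the next polynomial.
\<close>
lemma rodrigues_hermite:
  assumes "0 < t"
  shows "gauss_kernel_deriv n t y = (-1) ^ n * fact n / t ^ n * (poly (hermite n t) y * gauss_kernel t y)"
proof (induction n arbitrary: y)
  case 0
  then show ?case by (simp add: gauss_kernel_deriv_def)
next
  case (Suc n)
  have "gauss_kernel_deriv n t = (\<lambda>y. (-1) ^ n * fact n / t ^ n * (poly (hermite n t) y * gauss_kernel t y))"
    using Suc by blast
  then have "gauss_kernel_deriv (Suc n) t y =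
      deriv (\<lambda>y. (-1) ^ n * fact n / t ^ n * (poly (hermite n t) y * gauss_kernel t y)) y"
    by (metis gauss_kernel_deriv_def comp_apply funpow.simps(2) ext)
  also have "\<dots> = (-1) ^ n * fact n / t ^ n *
      (gauss_kernel t y * (poly (pderiv (hermite n t)) y - y / t * poly (hermite n t) y))"
    by (intro DERIV_imp_deriv DERIV_cmult poly_gauss_kernel_has_derivative assms)
  also have "poly (pderiv (hermite n t)) y - y / t * poly (hermite n t) y =
      - real (n + 1) / t * poly (hermite (Suc n) t) y"
    unfolding times_divide_eq_left minus_mult_left[symmetric] hermite_Suc_conv_pderiv
    using assms by (simp add: field_simps)
  finally show ?case using assms by (simp add: field_simps)
qed

lemma gauss_integrable_poly:
  assumes "0 < t"
  shows "integrable lborel (\<lambda>y. gauss_kernel t y * poly p y)"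
proof -
  have "integrable lborel (\<lambda>y. \<Sum>i\<le>degree p. coeff p i * (normal_density 0 (sqrt t) y * (y - 0) ^ i))"
    using assms by (intro Bochner_Integration.integrable_sum integrable_mult_right integrable_normal_moment) simp_all
  then show ?thesis
    using assms by (simp add: gauss_kernel_eq_normal_density poly_altdef sum_distrib_left mult_ac)
qed

lemma poly_gauss_kernel_tendsto_0:
  assumes "0 < t"
  shows "((\<lambda>y. poly p y * gauss_kernel t y) \<longlongrightarrow> 0) at_top"
    and "((\<lambda>y. poly p y * gauss_kernel t y) \<longlongrightarrow> 0) at_bot"
proof -
  have mono: "((\<lambda>y. y ^ i * gauss_kernel t y) \<longlongrightarrow> 0) at_top" for i
    using assms unfolding gauss_kernel_def by real_asymp
  have top: "((\<lambda>y. poly p y * gauss_kernel t y) \<longlongrightarrow> 0) at_top" for p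
  proof -
    have "((\<lambda>y. \<Sum>i\<le>degree p. coeff p i * (y ^ i * gauss_kernel t y)) \<longlongrightarrow> (\<Sum>i\<le>degree p. coeff p i * 0)) at_top"
      by (intro tendsto_intros mono)
    then show ?thesis by (simp add: poly_altdef sum_distrib_right mult.assoc)
  qed
  show "((\<lambda>y. poly p y * gauss_kernel t y) \<longlongrightarrow> 0) at_top" by (rule top)
  show "((\<lambda>y. poly p y * gauss_kernel t y) \<longlongrightarrow> 0) at_bot"
    using top[of "pcompose p [:0, -1:]"]
    by (simp add: filterlim_at_bot_mirror poly_pcompose gauss_kernel_minus)
qed

text \<open>
  The integrands are the derivative of \<open>- t\<close> times \<open>p\<close> times the kernel, which vanishes at both
  infinities.  The statement on the half line yields the chaos coefficients, the one on the whole
  line the orthogonality relations.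
\<close>
lemma gauss_integration_by_parts:
  assumes t: "0 < t"
  shows "(\<integral>y. gauss_kernel t y * (y * poly p y - t * poly (pderiv p) y) \<partial>lborel) = 0"
    and "(\<integral>y. gauss_kernel t y * (indicator {a..} y * (y * poly p y - t * poly (pderiv p) y)) \<partial>lborel) =
      t * (poly p a * gauss_kernel t a)"
proof -
  define F where "F y = - t * (poly p y * gauss_kernel t y)" for y
  define f where "f y = gauss_kernel t y * (y * poly p y - t * poly (pderiv p) y)" for y
  have F: "(F has_vector_derivative f y) (at y)" for y
    unfolding F_def f_def has_real_derivative_iff_has_vector_derivative[symmetric]
    using DERIV_cmult[OF poly_gauss_kernel_has_derivative[OF t, of p y], of "- t"] t
    by (simp add: algebra_simps)
  have cont: "isCont (gauss_kernel t) y" for y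
    using gauss_kernel_has_derivative[OF t] DERIV_isCont by blast
  have f: "isCont f y" for y
    unfolding f_def[abs_def] by (intro continuous_intros cont)
  have int: "integrable lborel f"
    using gauss_integrable_poly[OF t, of "[:0, 1:] * p - smult t (pderiv p)"]
    by (simp add: f_def[abs_def])
  have top: "(F \<longlongrightarrow> 0) at_top" and bot: "(F \<longlongrightarrow> 0) at_bot"
    unfolding F_def[abs_def]
    by (intro tendsto_mult_right_zero poly_gauss_kernel_tendsto_0 t)+
  have "(LBINT y=-\<infinity>..\<infinity>. f y) = 0 - 0"
    using F f top bot int
    by (intro interval_integral_FTC_integrable[of _ _ F f]) (auto simp: ereal_tendsto_simps set_integrable_def)
  then show "(\<integral>y. gauss_kernel t y * (y * poly p y - t * poly (pderiv p) y) \<partial>lborel) = 0"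
    by (simp add: interval_lebesgue_integral_def set_lebesgue_integral_def f_def)
  have "(LBINT y=ereal a..\<infinity>. f y) = 0 - F a"
    using F f top int DERIV_isCont[OF F[unfolded has_real_derivative_iff_has_vector_derivative[symmetric]], of a]
    by (intro interval_integral_FTC_integrable[of _ _ F f])
       (auto simp: ereal_tendsto_simps set_integrable_def isCont_def filterlim_at_split
         intro!: integrable_mult_indicator[of _ lborel f, simplified])
  also have "(LBINT y=ereal a..\<infinity>. f y) = (\<integral>y. indicator {a<..} y *\<^sub>R f y \<partial>lborel)"
    by (simp add: interval_lebesgue_integral_def set_lebesgue_integral_def)
  also have "\<dots> = (\<integral>y. gauss_kernel t y * (indicator {a..} y * (y * poly p y - t * poly (pderiv p) y)) \<partial>lborel)"
    using AE_lborel_singleton[of a]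
    by (intro integral_cong_AE) (auto simp: f_def split: split_indicator)
  finally show "(\<integral>y. gauss_kernel t y * (indicator {a..} y * (y * poly p y - t * poly (pderiv p) y)) \<partial>lborel) =
      t * (poly p a * gauss_kernel t a)"
    by (simp add: F_def)
qed

lemma gauss_integral_hermite_half_line:
  assumes "0 < t"
  shows "(\<integral>y. gauss_kernel t y * (indicator {a..} y * poly (hermite (Suc n) t) y) \<partial>lborel) =
    t / real (n + 1) * (poly (hermite n t) a * gauss_kernel t a)"
proof -
  have "(\<integral>y. real (n + 1) * (gauss_kernel t y * (indicator {a..} y * poly (hermite (Suc n) t) y)) \<partial>lborel) =
    t * (poly (hermite n t) a * gauss_kernel t a)"
    unfolding gauss_integration_by_parts(2)[OF assms, symmetric] hermite_Suc_conv_pderiv[symmetric]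
    by (simp add: mult_ac)
  then show ?thesis unfolding integral_mult_right_zero by (simp add: field_simps)
qed

text \<open>
  Lowering the index moves a derivative onto the other factor; repeating this until one factor is
  constant proves orthogonality.
\<close>
lemma gauss_integral_hermite_mult_poly:
  assumes "0 < t"
  shows "(\<integral>y. gauss_kernel t y * (poly p y * poly (hermite (Suc n) t) y) \<partial>lborel) =
    t / real (n + 1) * (\<integral>y. gauss_kernel t y * (poly (pderiv p) y * poly (hermite n t) y) \<partial>lborel)"
proof -
  define I where "I q = (\<integral>y. gauss_kernel t y * poly q y \<partial>lborel)" for q
  have int: "integrable lborel (\<lambda>y. gauss_kernel t y * poly q y)" for q
    by (rule gauss_integrable_poly[OF assms])
  have add: "I (q + r) = I q + I r" for q r
    using int[of q] int[of r] by (simp add: I_def distrib_left)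
  have smult: "I (smult c q) = c * I q" for c q
  proof -
    have "I (smult c q) = (\<integral>y. c * (gauss_kernel t y * poly q y) \<partial>lborel)"
      by (simp add: I_def mult_ac)
    then show ?thesis by (simp add: I_def)
  qed
  have "0 = I ([:0, 1:] * (p * hermite n t) - smult t (pderiv (p * hermite n t)))"
    using gauss_integration_by_parts(1)[OF assms, of "p * hermite n t"] by (simp add: I_def)
  also have "[:0, 1:] * (p * hermite n t) - smult t (pderiv (p * hermite n t)) =
      smult (real (n + 1)) (p * hermite (Suc n) t) + smult (- t) (pderiv p * hermite n t)"
    (is "?l = ?r")
  proof -
    have "poly ?l y = poly ?r y" for y
      using arg_cong[OF hermite_Suc_conv_pderiv[of n t y], of "\<lambda>u. poly p y * u"]
      by (simp add: pderiv_mult algebra_simps)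
    then show ?thesis unfolding poly_eq_poly_eq_iff[symmetric] by (rule ext)
  qed
  finally have "real (n + 1) * I (p * hermite (Suc n) t) = t * I (pderiv p * hermite n t)"
    by (simp only: add smult)
  then show ?thesis by (simp add: I_def field_simps)
qed

lemma gauss_integral_hermite_orthogonal:
  assumes "0 < t"
  shows "(\<integral>y. gauss_kernel t y * (poly (hermite m t) y * poly (hermite n t) y) \<partial>lborel) =
    (if m = n then t ^ n / fact n else 0)"
proof (induction n arbitrary: m)
  case 0
  show ?case
  proof (cases m)
    case 0
    then show ?thesis using assms by (simp add: gauss_kernel_eq_normal_density)
  next
    case (Suc k)
    then show ?thesis
      using gauss_integral_hermite_mult_poly[OF assms, of 1 k] by (simp add: pderiv_1)
  qed
next
  case (Suc n)
  show ?case
  proof (cases m)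
    case 0
    then show ?thesis
      using gauss_integral_hermite_mult_poly[OF assms, of 1 n] by (simp add: pderiv_1)
  next
    case (Suc k)
    then show ?thesis
      using gauss_integral_hermite_mult_poly[OF assms, of "hermite m t" n] Suc.IH[of k]
      by (simp add: pderiv_hermite)
  qed
qed

section \<open>Square-integrable functions\<close>
lemma square_integrable_mult:
  assumes "square_integrable M X" "square_integrable M Y"
  shows "integrable M (\<lambda>\<omega>. X \<omega> * Y \<omega>)"
proof (rule Bochner_Integration.integrable_bound)
  show "integrable M (\<lambda>\<omega>. (X \<omega>)\<^sup>2 + (Y \<omega>)\<^sup>2)"
    using assms by (simp add: square_integrable_def)
  show "(\<lambda>\<omega>. X \<omega> * Y \<omega>) \<in> borel_measurable M"
    using assms by (auto simp: square_integrable_def)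
  have "\<bar>a * b\<bar> \<le> a\<^sup>2 + b\<^sup>2" for a b :: real
    using sum_squares_bound[of a b] sum_squares_bound[of a "- b"] sum_squares_ge_zero[of a b]
    by (simp add: power2_eq_square abs_le_iff)
  then show "AE \<omega> in M. norm (X \<omega> * Y \<omega>) \<le> norm ((X \<omega>)\<^sup>2 + (Y \<omega>)\<^sup>2)"
    by (simp add: order_trans[OF _ abs_ge_self])
qed

lemma square_integrable_cmult:
  "square_integrable M X \<Longrightarrow> square_integrable M (\<lambda>\<omega>. c * X \<omega>)"
  by (auto simp: square_integrable_def power_mult_distrib)

lemma square_integrable_add:
  assumes "square_integrable M X" "square_integrable M Y"
  shows "square_integrable M (\<lambda>\<omega>. X \<omega> + Y \<omega>)"
proof -
  have "integrable M (\<lambda>\<omega>. (X \<omega>)\<^sup>2 + (Y \<omega>)\<^sup>2 + 2 * (X \<omega> * Y \<omega>))"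
    using assms square_integrable_mult[OF assms] by (simp add: square_integrable_def)
  then show ?thesis
    using assms by (auto simp: square_integrable_def power2_sum mult.assoc)
qed

lemma square_integrable_diff:
  assumes "square_integrable M X" "square_integrable M Y"
  shows "square_integrable M (\<lambda>\<omega>. X \<omega> - Y \<omega>)"
  using square_integrable_add[OF assms(1) square_integrable_cmult[OF assms(2), of "-1"]] by simp

lemma square_integrable_sum:
  "(\<And>i. i \<in> A \<Longrightarrow> square_integrable M (X i)) \<Longrightarrow> square_integrable M (\<lambda>\<omega>. \<Sum>i\<in>A. X i \<omega>)"
proof (induction A rule: infinite_finite_induct)
  case (insert i A)
  then show ?case using square_integrable_add[of M "X i"] by simp
qed (simp_all add: square_integrable_def)

lemma square_integrable_cong_AE:
  assumes "square_integrable M X" "Y \<in> borel_measurable M" "AE \<omega> in M. X \<omega> = Y \<omega>"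
  shows "square_integrable M Y"
proof -
  have [measurable]: "X \<in> borel_measurable M" "Y \<in> borel_measurable M"
    and int: "integrable M (\<lambda>\<omega>. (X \<omega>)\<^sup>2)"
    using assms(1,2) by (simp_all add: square_integrable_def)
  have "AE \<omega> in M. (X \<omega>)\<^sup>2 = (Y \<omega>)\<^sup>2"
    using assms(3) by eventually_elim simp
  then have "integrable M (\<lambda>\<omega>. (Y \<omega>)\<^sup>2)"
    by (rule integrable_cong_AE_imp[OF int, rotated]) measurable
  with assms(2) show ?thesis by (simp add: square_integrable_def)
qed

section \<open>Increments of Brownian motion\<close>
lemma poly_distributed_gauss:
  assumes "0 < t" "distributed M lborel X (\<lambda>y. ennreal (gauss_kernel t y))"
  shows "integrable M (\<lambda>\<omega>. poly p (X \<omega>))"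
  using distributed_integrable[OF assms(2), of "poly p"] gauss_integrable_poly[OF assms(1)]
    gauss_kernel_nonneg[OF assms(1)] by simp

lemma hermite_distributed_gauss:
  assumes "0 < t" "distributed M lborel X (\<lambda>y. ennreal (gauss_kernel t y))"
  shows "(\<integral>\<omega>. poly (hermite m t) (X \<omega>) * poly (hermite n t) (X \<omega>) \<partial>M) =
    (if m = n then t ^ n / fact n else 0)"
  using distributed_integral[OF assms(2), of "\<lambda>y. poly (hermite m t) y * poly (hermite n t) y"]
    gauss_integral_hermite_orthogonal[OF assms(1)] gauss_kernel_nonneg[OF assms(1)] by simp

lemma hermite_0_0: "poly (hermite n 0) 0 = (if n = 0 then 1 else 0)"
  by (cases "(n, 0 :: real)" rule: hermite.cases) simp_all

lemma brownian_prob_space: "brownian_motion M x W \<Longrightarrow> prob_space M"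
  unfolding brownian_motion_def by (elim conjE)

lemma brownian_measurable: "brownian_motion M x W \<Longrightarrow> 0 \<le> t \<Longrightarrow> W t \<in> borel_measurable M"
  unfolding brownian_motion_def by (elim conjE allE[of _ t]) blast

lemma brownian_start: "brownian_motion M x W \<Longrightarrow> AE \<omega> in M. W 0 \<omega> = x"
  unfolding brownian_motion_def by (elim conjE)

lemma brownian_continuous: "brownian_motion M x W \<Longrightarrow> AE \<omega> in M. continuous_on {0..} (\<lambda>t. W t \<omega>)"
  unfolding brownian_motion_def by (elim conjE)

lemma brownian_increment_distributed:
  assumes "brownian_motion M x W" "0 \<le> s" "s < t"
  shows "distributed M lborel (\<lambda>\<omega>. W t \<omega> - W s \<omega>) (\<lambda>y. ennreal (gauss_kernel (t - s) y))"
proof -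
  have "\<forall>s t. 0 \<le> s \<longrightarrow> s < t \<longrightarrow> distributed M lborel (\<lambda>\<omega>. W t \<omega> - W s \<omega>)
      (\<lambda>y. ennreal (normal_density 0 (sqrt (t - s)) y))"
    using assms(1) unfolding brownian_motion_def by (elim conjE)
  then show ?thesis using assms(2,3) by (simp add: gauss_kernel_eq_normal_density)
qed

lemma brownian_increments_indep:
  fixes \<tau> :: "nat \<Rightarrow> real"
  assumes "brownian_motion M x W" "0 \<le> \<tau> 0" "\<And>i. i < n \<Longrightarrow> \<tau> i < \<tau> (Suc i)"
  shows "prob_space.indep_vars M (\<lambda>_. borel) (\<lambda>i \<omega>. W (\<tau> (Suc i)) \<omega> - W (\<tau> i) \<omega>) {..<n}"
proof -
  have "\<forall>n (\<tau> :: nat \<Rightarrow> real). 0 \<le> \<tau> 0 \<longrightarrow> (\<forall>i<n. \<tau> i < \<tau> (Suc i)) \<longrightarrow>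
      prob_space.indep_vars M (\<lambda>_. borel) (\<lambda>i \<omega>. W (\<tau> (Suc i)) \<omega> - W (\<tau> i) \<omega>) {..<n}"
    using assms(1) unfolding brownian_motion_def by (elim conjE)
  then show ?thesis using assms(2,3) by blast
qed

lemma brownian_increment_poly_integrable:
  assumes "brownian_motion M x W" "0 \<le> s" "s < t"
  shows "integrable M (\<lambda>\<omega>. poly p (W t \<omega> - W s \<omega>))"
  using assms by (intro poly_distributed_gauss[of "t - s"] brownian_increment_distributed) simp_all

lemma brownian_poly_integrable:
  assumes "brownian_motion M x W" "0 \<le> t"
  shows "integrable M (\<lambda>\<omega>. poly p (W t \<omega> - W 0 \<omega>))"
proof (cases "t = 0")
  case True
  interpret prob_space M by (rule brownian_prob_space[OF assms(1)])
  show ?thesis using True by simp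
qed (use assms in \<open>auto intro: brownian_increment_poly_integrable\<close>)

lemma brownian_poly_square_integrable:
  assumes "brownian_motion M x W" "0 \<le> t"
  shows "square_integrable M (\<lambda>\<omega>. poly p (W t \<omega> - W 0 \<omega>))"
  unfolding square_integrable_def
  using brownian_poly_integrable[OF assms, of p] brownian_poly_integrable[OF assms, of "p\<^sup>2"]
  by simp

text \<open>
  At \<open>t = 0\<close> this holds with \<open>0\<^sup>0 = 1\<close>, because \<open>hermite n 0\<close> vanishes at \<open>0\<close> unless \<open>n = 0\<close>.  Including
  this case spares a separate treatment of the first step of a partition.
\<close>
lemma brownian_hermite_orthogonal:
  assumes "brownian_motion M x W" "0 \<le> t"
  shows "(\<integral>\<omega>. poly (hermite m t) (W t \<omega> - W 0 \<omega>) * poly (hermite n t) (W t \<omega> - W 0 \<omega>) \<partial>M) =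
    (if m = n then t ^ n / fact n else 0)"
proof (cases "t = 0")
  case True
  interpret prob_space M by (rule brownian_prob_space[OF assms(1)])
  show ?thesis using True by (auto simp: hermite_0_0 prob_space power_0_left)
next
  case False
  then show ?thesis
    using assms hermite_distributed_gauss[OF _ brownian_increment_distributed[of M x W 0 t]] by simp
qed

text \<open>
  \<open>X\<close> is any Borel function of the increments up to time \<open>\<tau> m\<close>.  Independence from the next increment
  follows by grouping the independent increments into those before and the one after \<open>\<tau> m\<close>.
\<close>
lemma brownian_increment_indep_past:
  assumes bm: "brownian_motion M x W" and "0 \<le> \<tau> 0" and \<tau>: "\<And>i. i \<le> m \<Longrightarrow> \<tau> i < \<tau> (Suc i)"
    and \<Phi>: "\<Phi> \<in> borel_measurable (PiM {..<m} (\<lambda>_. borel))"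
    and X: "\<And>\<omega>. X \<omega> = \<Phi> (\<lambda>i\<in>{..<m}. W (\<tau> (Suc i)) \<omega> - W (\<tau> i) \<omega>)"
  shows "prob_space.indep_var M borel X borel (\<lambda>\<omega>. W (\<tau> (Suc m)) \<omega> - W (\<tau> m) \<omega>)"
proof -
  interpret prob_space M by (rule brownian_prob_space[OF bm])
  define D where "D i \<omega> = W (\<tau> (Suc i)) \<omega> - W (\<tau> i) \<omega>" for i \<omega>
  have "indep_vars (\<lambda>_. borel) (\<lambda>i \<omega>. W (\<tau> (Suc i)) \<omega> - W (\<tau> i) \<omega>) {..<Suc m}"
    using \<tau> by (intro brownian_increments_indep[where \<tau>=\<tau>, OF bm assms(2)]) simp
  then have "indep_vars (\<lambda>_. borel) D {..<Suc m}" by (simp add: D_def[abs_def])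
  then have "indep_var (PiM {..<m} (\<lambda>_. borel)) (\<lambda>\<omega>. \<lambda>i\<in>{..<m}. D i \<omega>)
      (PiM {m} (\<lambda>_. borel)) (\<lambda>\<omega>. \<lambda>i\<in>{m}. D i \<omega>)"
    by (rule indep_var_restrict) auto
  then have "indep_var borel (\<Phi> \<circ> (\<lambda>\<omega>. \<lambda>i\<in>{..<m}. D i \<omega>)) borel ((\<lambda>v. v m) \<circ> (\<lambda>\<omega>. \<lambda>i\<in>{m}. D i \<omega>))"
    by (rule indep_var_compose) (use \<Phi> in measurable)
  moreover have "\<Phi> \<circ> (\<lambda>\<omega>. \<lambda>i\<in>{..<m}. D i \<omega>) = X"
    by (rule ext) (simp add: X D_def)
  ultimately show ?thesis by (simp add: comp_def D_def)
qed

lemma brownian_increment_indep: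
  assumes bm: "brownian_motion M x W" and "0 \<le> s" "s < t"
  shows "prob_space.indep_var M borel (\<lambda>\<omega>. W s \<omega> - W 0 \<omega>) borel (\<lambda>\<omega>. W t \<omega> - W s \<omega>)"
proof (cases "s = 0")
  case True
  show ?thesis
    using assms True by (auto intro!: brownian_increment_indep_past[of M x W "\<lambda>i. real i * t" 0 "\<lambda>_. 0", simplified])
next
  case False
  \<comment> \<open>the partition \<open>0 < s < t\<close>; for \<open>s = 0\<close> it would not be strictly increasing\<close>
  define \<tau> where "\<tau> i = (if i = 0 then 0 else if i = 1 then s else t)" for i :: nat
  have "prob_space.indep_var M borel (\<lambda>\<omega>. W s \<omega> - W 0 \<omega>) borel (\<lambda>\<omega>. W (\<tau> (Suc 1)) \<omega> - W (\<tau> 1) \<omega>)"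
    by (rule brownian_increment_indep_past[OF bm, where \<Phi> = "\<lambda>v. v 0"])
       (use assms False in \<open>auto simp: \<tau>_def le_Suc_eq\<close>)
  then show ?thesis by (simp add: \<tau>_def)
qed

text \<open>
  For \<open>J = {..n}\<close> the sum is \<open>h\<^sub>n(t, B\<^sub>t)\<close> by the addition formula; smaller sets \<open>J\<close> give the
  remainders left after splitting off the leading terms.  Distinct summands are orthogonal
  because the factors in the increment are independent of the past and orthogonal to each other.
\<close>
lemma hermite_increment_square:
  assumes bm: "brownian_motion M x W" and st: "0 \<le> s" "s < t"
  shows "square_integrable M (\<lambda>\<omega>. \<Sum>j\<in>J. poly (hermite (n - j) s) (W s \<omega> - W 0 \<omega>) *
           poly (hermite j (t - s)) (W t \<omega> - W s \<omega>))" (is "square_integrable M (\<lambda>\<omega>. \<Sum>j\<in>J. ?a j \<omega> * ?b j \<omega>)")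
    and "finite J \<Longrightarrow> J \<subseteq> {..n} \<Longrightarrow> (\<integral>\<omega>. (\<Sum>j\<in>J. poly (hermite (n - j) s) (W s \<omega> - W 0 \<omega>) *
           poly (hermite j (t - s)) (W t \<omega> - W s \<omega>))\<^sup>2 \<partial>M) =
         (\<Sum>j\<in>J. s ^ (n - j) / fact (n - j) * ((t - s) ^ j / fact j))"
proof -
  interpret prob_space M by (rule brownian_prob_space[OF bm])
  have prod: "integrable M (\<lambda>\<omega>. poly p (W s \<omega> - W 0 \<omega>) * poly q (W t \<omega> - W s \<omega>))"
    "(\<integral>\<omega>. poly p (W s \<omega> - W 0 \<omega>) * poly q (W t \<omega> - W s \<omega>) \<partial>M) =
      (\<integral>\<omega>. poly p (W s \<omega> - W 0 \<omega>) \<partial>M) * (\<integral>\<omega>. poly q (W t \<omega> - W s \<omega>) \<partial>M)" for p q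
  proof -
    have "indep_var borel (poly p \<circ> (\<lambda>\<omega>. W s \<omega> - W 0 \<omega>)) borel (poly q \<circ> (\<lambda>\<omega>. W t \<omega> - W s \<omega>))"
      by (intro indep_var_compose[OF brownian_increment_indep[OF bm st]]) simp_all
    then have ind: "indep_var borel (\<lambda>\<omega>. poly p (W s \<omega> - W 0 \<omega>)) borel (\<lambda>\<omega>. poly q (W t \<omega> - W s \<omega>))"
      by (simp add: comp_def)
    have int: "integrable M (\<lambda>\<omega>. poly p (W s \<omega> - W 0 \<omega>))" "integrable M (\<lambda>\<omega>. poly q (W t \<omega> - W s \<omega>))"
      using brownian_poly_integrable[OF bm st(1)] brownian_increment_poly_integrable[OF bm st] by auto
    show "integrable M (\<lambda>\<omega>. poly p (W s \<omega> - W 0 \<omega>) * poly q (W t \<omega> - W s \<omega>))"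
      "(\<integral>\<omega>. poly p (W s \<omega> - W 0 \<omega>) * poly q (W t \<omega> - W s \<omega>) \<partial>M) =
      (\<integral>\<omega>. poly p (W s \<omega> - W 0 \<omega>) \<partial>M) * (\<integral>\<omega>. poly q (W t \<omega> - W s \<omega>) \<partial>M)"
      using indep_var_integrable[OF ind int] indep_var_lebesgue_integral[OF ind int] by auto
  qed
  have cross_eq: "?a j \<omega> * ?b j \<omega> * (?a l \<omega> * ?b l \<omega>) =
      poly (hermite (n - j) s * hermite (n - l) s) (W s \<omega> - W 0 \<omega>) *
      poly (hermite j (t - s) * hermite l (t - s)) (W t \<omega> - W s \<omega>)" for j l \<omega>
    by simp
  have cross_int: "integrable M (\<lambda>\<omega>. ?a j \<omega> * ?b j \<omega> * (?a l \<omega> * ?b l \<omega>))" for j l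
    unfolding cross_eq by (rule prod)
  have cross: "(\<integral>\<omega>. ?a j \<omega> * ?b j \<omega> * (?a l \<omega> * ?b l \<omega>) \<partial>M) =
     (if j = l then s ^ (n - j) / fact (n - j) * ((t - s) ^ j / fact j) else 0)" for j l
  proof -
    have "(\<integral>\<omega>. ?a j \<omega> * ?b j \<omega> * (?a l \<omega> * ?b l \<omega>) \<partial>M) =
        (\<integral>\<omega>. poly (hermite (n - j) s * hermite (n - l) s) (W s \<omega> - W 0 \<omega>) \<partial>M) *
        (\<integral>\<omega>. poly (hermite j (t - s) * hermite l (t - s)) (W t \<omega> - W s \<omega>) \<partial>M)"
      unfolding cross_eq by (rule prod(2))
    then show ?thesis
      using brownian_hermite_orthogonal[OF bm st(1), of "n - j" "n - l"] st
        hermite_distributed_gauss[OF _ brownian_increment_distributed[OF bm st], of j l] by simp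
  qed
  have sq: "(\<Sum>j\<in>J. ?a j \<omega> * ?b j \<omega>)\<^sup>2 = (\<Sum>j\<in>J. \<Sum>l\<in>J. ?a j \<omega> * ?b j \<omega> * (?a l \<omega> * ?b l \<omega>))" for \<omega>
    unfolding power2_eq_square by (rule sum_product)
  have "(\<lambda>\<omega>. \<Sum>j\<in>J. ?a j \<omega> * ?b j \<omega>) \<in> borel_measurable M"
    using borel_measurable_integrable[OF prod(1)] by (intro borel_measurable_sum) auto
  then show "square_integrable M (\<lambda>\<omega>. \<Sum>j\<in>J. ?a j \<omega> * ?b j \<omega>)"
    unfolding square_integrable_def sq using cross_int
    by (auto intro!: Bochner_Integration.integrable_sum)
  assume J: "finite J" "J \<subseteq> {..n}"
  show "(\<integral>\<omega>. (\<Sum>j\<in>J. ?a j \<omega> * ?b j \<omega>)\<^sup>2 \<partial>M) = (\<Sum>j\<in>J. s ^ (n - j) / fact (n - j) * ((t - s) ^ j / fact j))"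
    unfolding sq using cross_int J
    by (simp add: Bochner_Integration.integral_sum cross)
qed

text \<open>
  A remainder that starts at order \<open>l\<close> has variance of order \<open>(t - s)\<^sup>l\<close>: the case \<open>l = 1\<close> controls the
  elementary integrands, the case \<open>l = 2\<close> the elementary integrals.
\<close>
lemma hermite_increment_square_le:
  assumes bm: "brownian_motion M x W" and st: "0 \<le> s" "s < t" "t \<le> T"
  shows "(\<integral>\<omega>. (\<Sum>j\<in>{l..n}. poly (hermite (n - j) s) (W s \<omega> - W 0 \<omega>) *
           poly (hermite j (t - s)) (W t \<omega> - W s \<omega>))\<^sup>2 \<partial>M) \<le>
         real (Suc n) * T ^ (n - l) * (t - s) ^ l" (is "?L \<le> _")
proof -
  have "?L = (\<Sum>j\<in>{l..n}. s ^ (n - j) / fact (n - j) * ((t - s) ^ j / fact j))"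
    using hermite_increment_square(2)[OF bm st(1,2), of "{l..n}" n] by auto
  also have "\<dots> \<le> (\<Sum>j\<in>{l..n}. T ^ (n - l) * (t - s) ^ l)"
  proof (rule sum_mono)
    fix j assume j: "j \<in> {l..n}"
    have "s ^ (n - j) / fact (n - j) * ((t - s) ^ j / fact j) \<le> s ^ (n - j) * (t - s) ^ j"
      using st by (intro mult_mono) (auto simp: divide_le_eq mult_le_cancel_left1)
    also have "\<dots> = s ^ (n - j) * (t - s) ^ (j - l) * (t - s) ^ l"
      using j by (simp flip: power_add)
    also have "\<dots> \<le> T ^ (n - j) * T ^ (j - l) * (t - s) ^ l"
      using st by (intro mult_right_mono mult_mono power_mono) auto
    also have "T ^ (n - j) * T ^ (j - l) = T ^ (n - l)"
      using j by (simp flip: power_add)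
    finally show "s ^ (n - j) / fact (n - j) * ((t - s) ^ j / fact j) \<le> T ^ (n - l) * (t - s) ^ l" .
  qed
  also have "\<dots> = real (Suc n - l) * (T ^ (n - l) * (t - s) ^ l)" by simp
  also have "\<dots> \<le> real (Suc n) * (T ^ (n - l) * (t - s) ^ l)"
    using st by (intro mult_right_mono) auto
  finally show ?thesis by (simp add: mult.assoc)
qed

text \<open>
  \<open>R m\<close> is the error after \<open>m\<close> steps of length \<open>d\<close> when \<open>h\<^sub>n\<^sub>+\<^sub>1(t, B\<^sub>t)\<close> is replaced by the Riemann-type sum
  for the integral of \<open>h\<^sub>n(t, B\<^sub>t)\<close>.  The next step adds a remainder of order two that is orthogonal
  to the previous error, so the second moments of the steps add up.  With \<open>m = T / d\<close> the bound is
  of order \<open>d\<close>.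
\<close>
lemma hermite_riemann_error:
  assumes bm: "brownian_motion M x W" and d: "0 < d"
    and R: "\<And>m \<omega>. R m \<omega> = poly (hermite (Suc n) (real m * d)) (W (real m * d) \<omega> - W 0 \<omega>) -
      (\<Sum>i<m. poly (hermite n (real i * d)) (W (real i * d) \<omega> - W 0 \<omega>) *
         (W (real (Suc i) * d) \<omega> - W (real i * d) \<omega>))"
  shows "square_integrable M (R m) \<and>
    (\<integral>\<omega>. (R m \<omega>)\<^sup>2 \<partial>M) \<le> real m * (real (n + 2) * (real m * d) ^ (n - 1) * d\<^sup>2)"
proof (induction m)
  case 0
  have "R 0 \<omega> = 0" for \<omega> by (simp add: R hermite_0_0)
  then show ?case by (simp add: square_integrable_def)
next
  case (Suc m)
  interpret prob_space M by (rule brownian_prob_space[OF bm])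
  define s where "s = real m * d"
  define t where "t = real (Suc m) * d"
  have st: "0 \<le> s" "s < t" "t - s = d" using d by (auto simp: s_def t_def field_simps)
  define a where "a j \<omega> = poly (hermite (Suc n - j) s) (W s \<omega> - W 0 \<omega>)" for j \<omega>
  define b where "b j \<omega> = poly (hermite j d) (W t \<omega> - W s \<omega>)" for j \<omega>
  define D where "D \<omega> = (\<Sum>j\<in>{2..Suc n}. a j \<omega> * b j \<omega>)" for \<omega>
  have RS: "R (Suc m) \<omega> = R m \<omega> + D \<omega>" for \<omega>
  proof -
    have "poly (hermite (Suc n) t) (W t \<omega> - W 0 \<omega>) =
        poly (hermite (Suc n) (s + d)) ((W s \<omega> - W 0 \<omega>) + (W t \<omega> - W s \<omega>))"
      using st by (simp add: algebra_simps)
    also have "\<dots> = (\<Sum>j\<le>Suc n. a j \<omega> * b j \<omega>)"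
      unfolding hermite_add a_def b_def ..
    also have "{..Suc n} = {0, 1} \<union> {2..Suc n}" by auto
    also have "(\<Sum>j\<in>{0, 1} \<union> {2..Suc n}. a j \<omega> * b j \<omega>) = a 0 \<omega> * b 0 \<omega> + a 1 \<omega> * b 1 \<omega> + D \<omega>"
      unfolding D_def by (subst sum.union_disjoint) auto
    also have "a 0 \<omega> * b 0 \<omega> + a 1 \<omega> * b 1 \<omega> = poly (hermite (Suc n) s) (W s \<omega> - W 0 \<omega>) +
        poly (hermite n s) (W s \<omega> - W 0 \<omega>) * (W t \<omega> - W s \<omega>)"
      by (simp add: a_def b_def)
    finally show ?thesis
      unfolding R[of "Suc m"] R[of m] sum.lessThan_Suc s_def[symmetric] t_def[symmetric] by simp
  qed
  have D_sq: "square_integrable M D"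
    using hermite_increment_square(1)[OF bm st(1,2), of "Suc n" "{2..Suc n}"] st
    by (simp add: D_def[abs_def] a_def b_def)
  have D_le: "(\<integral>\<omega>. (D \<omega>)\<^sup>2 \<partial>M) \<le> real (n + 2) * t ^ (n - 1) * d\<^sup>2"
    using hermite_increment_square_le[OF bm st(1,2) order_refl, of "Suc n" 2]
    unfolding D_def a_def b_def st(3) diff_Suc_1 by (simp del: sum.cl_ivl_Suc)
  have R_sq: "square_integrable M (R m)" using Suc by simp
  have zero: "(\<integral>\<omega>. R m \<omega> * (a j \<omega> * b j \<omega>) \<partial>M) = 0" "integrable M (\<lambda>\<omega>. R m \<omega> * (a j \<omega> * b j \<omega>))"
    if "j \<in> {2..Suc n}" for j
  proof -
    define \<tau> where "\<tau> i = real i * d" for i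
    have tele: "(\<Sum>i<k. W (\<tau> (Suc i)) \<omega> - W (\<tau> i) \<omega>) = W (\<tau> k) \<omega> - W 0 \<omega>" for k \<omega>
      using sum_lessThan_telescope[of "\<lambda>i. W (\<tau> i) \<omega>" k] by (simp add: \<tau>_def)
    \<comment> \<open>\<open>R m * a j\<close> as a function of the increments before \<open>s\<close>, whose partial sums are the values of \<open>W - W 0\<close>\<close>
    define \<Phi> where "\<Phi> v = (poly (hermite (Suc n) s) (\<Sum>i<m. v i) -
       (\<Sum>i<m. poly (hermite n (\<tau> i)) (\<Sum>k<i. v k) * v i)) * poly (hermite (Suc n - j) s) (\<Sum>i<m. v i)"
      for v :: "nat \<Rightarrow> real"
    have "indep_var borel (\<lambda>\<omega>. R m \<omega> * a j \<omega>) borel (\<lambda>\<omega>. W (\<tau> (Suc m)) \<omega> - W (\<tau> m) \<omega>)"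
    proof (rule brownian_increment_indep_past[OF bm, where \<Phi> = \<Phi>])
      have comp: "(\<lambda>v. v i) \<in> borel_measurable (PiM {..<m} (\<lambda>_. borel :: real measure))" if "i < m" for i
        using that by (intro measurable_component_singleton) simp
      have sums: "(\<lambda>v. \<Sum>k<i. v k) \<in> borel_measurable (PiM {..<m} (\<lambda>_. borel :: real measure))" if "i \<le> m" for i
        using that by (intro borel_measurable_sum comp) simp
      have polys: "(\<lambda>v. poly p (\<Sum>k<i. v k)) \<in> borel_measurable (PiM {..<m} (\<lambda>_. borel :: real measure))"
        if "i \<le> m" for i p
        by (rule measurable_compose[OF sums[OF that] poly_measurable])
      show "\<Phi> \<in> borel_measurable (PiM {..<m} (\<lambda>_. borel))"
        unfolding \<Phi>_def[abs_def]
        by (intro borel_measurable_times borel_measurable_diff borel_measurable_sum polys comp) auto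
      fix \<omega>
      have "(\<Sum>k<i. (\<lambda>i\<in>{..<m}. W (\<tau> (Suc i)) \<omega> - W (\<tau> i) \<omega>) k) = W (\<tau> i) \<omega> - W 0 \<omega>" if "i \<le> m" for i
        using that by (subst tele[symmetric], intro sum.cong) auto
      then show "R m \<omega> * a j \<omega> = \<Phi> (\<lambda>i\<in>{..<m}. W (\<tau> (Suc i)) \<omega> - W (\<tau> i) \<omega>)"
        by (simp add: \<Phi>_def R a_def) (simp add: \<tau>_def s_def)
    qed (use d in \<open>auto simp: \<tau>_def\<close>)
    then have "indep_var borel (id \<circ> (\<lambda>\<omega>. R m \<omega> * a j \<omega>)) borel
        (poly (hermite j d) \<circ> (\<lambda>\<omega>. W t \<omega> - W s \<omega>))"
      unfolding \<tau>_def s_def[symmetric] t_def[symmetric]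
      by (rule indep_var_compose) measurable
    then have ind: "indep_var borel (\<lambda>\<omega>. R m \<omega> * a j \<omega>) borel (b j)"
      by (simp add: comp_def b_def[abs_def])
    have int: "integrable M (\<lambda>\<omega>. R m \<omega> * a j \<omega>)" "integrable M (b j)"
      unfolding a_def b_def[abs_def]
      by (intro square_integrable_mult R_sq brownian_poly_square_integrable[OF bm st(1)]
            brownian_increment_poly_integrable[OF bm st(1,2)])+
    have "(\<integral>\<omega>. b j \<omega> \<partial>M) = 0"
      using hermite_distributed_gauss[OF _ brownian_increment_distributed[OF bm st(1,2)], of j 0] that st d
      by (simp add: b_def)
    with indep_var_lebesgue_integral[OF ind int] show "(\<integral>\<omega>. R m \<omega> * (a j \<omega> * b j \<omega>) \<partial>M) = 0"
      by (simp add: mult.assoc)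
    show "integrable M (\<lambda>\<omega>. R m \<omega> * (a j \<omega> * b j \<omega>))"
      using indep_var_integrable[OF ind int] by (simp add: mult.assoc)
  qed
  have RD: "(\<integral>\<omega>. R m \<omega> * D \<omega> \<partial>M) = 0"
    unfolding D_def sum_distrib_left using zero by (subst Bochner_Integration.integral_sum) auto
  have "(\<integral>\<omega>. (R (Suc m) \<omega>)\<^sup>2 \<partial>M) = (\<integral>\<omega>. (R m \<omega>)\<^sup>2 + (D \<omega>)\<^sup>2 + 2 * (R m \<omega> * D \<omega>) \<partial>M)"
    by (simp add: RS power2_sum mult.assoc)
  also have "\<dots> = (\<integral>\<omega>. (R m \<omega>)\<^sup>2 \<partial>M) + (\<integral>\<omega>. (D \<omega>)\<^sup>2 \<partial>M)"
    using R_sq D_sq square_integrable_mult[OF R_sq D_sq] RD by (simp add: square_integrable_def)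
  also have "\<dots> \<le> real m * (real (n + 2) * (real m * d) ^ (n - 1) * d\<^sup>2) + real (n + 2) * t ^ (n - 1) * d\<^sup>2"
    using Suc D_le by (intro add_mono) auto
  also have "\<dots> \<le> real m * (real (n + 2) * t ^ (n - 1) * d\<^sup>2) + real (n + 2) * t ^ (n - 1) * d\<^sup>2"
    using d by (intro add_mono mult_mono power_mono) (auto simp: t_def)
  also have "\<dots> = real (Suc m) * (real (n + 2) * t ^ (n - 1) * d\<^sup>2)"
    by (simp add: algebra_simps)
  finally show ?case
    using square_integrable_add[OF R_sq D_sq] unfolding RS t_def by simp
qed

section \<open>Iterated integrals of constants\<close>

text \<open>
  The paths of \<open>W\<close> are continuous only almost surely, so \<open>W\<close> need not be measurable in time and
  \<open>\<omega>\<close> jointly.  The limit along grid points to the left of \<open>t\<close> is jointly measurable whatever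
  the paths are, and it is a version of \<open>W\<close>; it serves as the integrand in the iterated integrals.
\<close>
definition grid_limit :: "(real \<Rightarrow> 'a \<Rightarrow> real) \<Rightarrow> real \<Rightarrow> 'a \<Rightarrow> real" where
  "grid_limit W t \<omega> = lim (\<lambda>k. W (real (nat \<lfloor>t * real (Suc k)\<rfloor>) / real (Suc k)) \<omega>)"

lemma grid_limit_measurable:
  assumes "\<And>t. 0 \<le> t \<Longrightarrow> W t \<in> borel_measurable M"
  shows "(\<lambda>z. grid_limit W (fst z) (snd z)) \<in> borel_measurable (borel \<Otimes>\<^sub>M M)"
  unfolding grid_limit_def
proof (rule borel_measurable_lim_metric)
  fix k
  show "(\<lambda>z. W (real (nat \<lfloor>fst z * real (Suc k)\<rfloor>) / real (Suc k)) (snd z)) \<in> borel_measurable (borel \<Otimes>\<^sub>M M)"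
  proof (rule measurable_compose_countable[where f = "\<lambda>i z. W (real i / real (Suc k)) (snd z)"])
    show "(\<lambda>z. W (real i / real (Suc k)) (snd z)) \<in> borel_measurable (borel \<Otimes>\<^sub>M M)" for i
      by (rule measurable_compose[OF measurable_snd assms]) simp
    show "(\<lambda>z. nat \<lfloor>fst z * real (Suc k)\<rfloor>) \<in> measurable (borel \<Otimes>\<^sub>M M) (count_space UNIV)"
      by measurable
  qed
qed

lemma grid_limit_measurable_section:
  assumes "\<And>t. 0 \<le> t \<Longrightarrow> W t \<in> borel_measurable M"
  shows "grid_limit W t \<in> borel_measurable M"
  unfolding grid_limit_def[abs_def] by (intro borel_measurable_lim_metric assms) simp

lemma grid_limit_eq:
  assumes "continuous_on {0..} (\<lambda>t. W t \<omega>)" "0 \<le> t"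
  shows "grid_limit W t \<omega> = W t \<omega>"
proof -
  define q where "q k = real (nat \<lfloor>t * real (Suc k)\<rfloor>) / real (Suc k)" for k
  have q_le: "q k \<le> t" and q_ge: "t - 1 / real (Suc k) \<le> q k" for k
  proof -
    have nat: "real (nat \<lfloor>t * real (Suc k)\<rfloor>) = real_of_int \<lfloor>t * real (Suc k)\<rfloor>"
      using assms(2) by (intro of_nat_nat) simp
    have "real (nat \<lfloor>t * real (Suc k)\<rfloor>) \<le> t * real (Suc k)"
      unfolding nat by (rule of_int_floor_le)
    then show "q k \<le> t" by (simp add: q_def field_simps)
    have "t * real (Suc k) - 1 \<le> real (nat \<lfloor>t * real (Suc k)\<rfloor>)"
      unfolding nat by linarith
    then have "(t * real (Suc k) - 1) / real (Suc k) \<le> q k"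
      unfolding q_def by (intro divide_right_mono) simp_all
    then show "t - 1 / real (Suc k) \<le> q k" by (simp add: diff_divide_distrib del: of_nat_Suc)
  qed
  have "(\<lambda>k. t - 1 / real (Suc k)) \<longlonglongrightarrow> t - 0"
    by (intro tendsto_intros LIMSEQ_Suc lim_1_over_n)
  then have "q \<longlonglongrightarrow> t"
    by (intro tendsto_sandwich[of "\<lambda>k. t - 1 / real (Suc k)" q _ "\<lambda>_. t"] always_eventually allI q_le q_ge)
       simp_all
  then have "(\<lambda>k. W (q k) \<omega>) \<longlonglongrightarrow> W t \<omega>"
    by (rule continuous_on_tendsto_compose[OF assms(1)]) (use assms(2) in \<open>auto simp: q_def\<close>)
  then show ?thesis by (simp add: grid_limit_def q_def limI)
qed

lemma brownian_grid_limit_AE: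
  assumes "brownian_motion M x W" "0 \<le> t"
  shows "AE \<omega> in M. grid_limit W t \<omega> = W t \<omega>"
  using brownian_continuous[OF assms(1)]
  by eventually_elim (rule grid_limit_eq[OF _ assms(2)])

lemma L2_tendstoI_bound:
  assumes "\<And>k. square_integrable M (X k)" "square_integrable M Y"
    and "\<And>k. (\<integral>\<omega>. (X k \<omega> - Y \<omega>)\<^sup>2 \<partial>M) \<le> C k" "C \<longlonglongrightarrow> 0"
  shows "L2_tendsto M X Y"
proof -
  have "(\<lambda>k. \<integral>\<omega>. (X k \<omega> - Y \<omega>)\<^sup>2 \<partial>M) \<longlonglongrightarrow> 0"
    by (rule tendsto_sandwich[OF _ _ tendsto_const assms(4)])
       (auto intro!: always_eventually assms(3))
  then show ?thesis using assms(1,2) by (simp add: L2_tendsto_def)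
qed

text \<open>
  Tonelli's theorem reduces convergence in \<open>L\<^sup>2([0, T] \<times> \<Omega>)\<close> to bounds in \<open>L\<^sup>2(\<Omega>)\<close> that are uniform in
  time.
\<close>
lemma product_square_integrable_bound:
  assumes "prob_space M" "0 \<le> T" "0 \<le> C"
    and f: "f \<in> borel_measurable (restrict_space lborel {0..T} \<Otimes>\<^sub>M M)"
    and sq: "\<And>t. 0 < t \<Longrightarrow> t \<le> T \<Longrightarrow> square_integrable M (\<lambda>\<omega>. f (t, \<omega>))"
    and le: "\<And>t. 0 < t \<Longrightarrow> t \<le> T \<Longrightarrow> (\<integral>\<omega>. (f (t, \<omega>))\<^sup>2 \<partial>M) \<le> C"
  shows "square_integrable (restrict_space lborel {0..T} \<Otimes>\<^sub>M M) f"
    and "(\<integral>z. (f z)\<^sup>2 \<partial>(restrict_space lborel {0..T} \<Otimes>\<^sub>M M)) \<le> C * T"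
proof -
  interpret prob_space M by fact
  let ?L = "restrict_space lborel {0..T}" and ?P = "restrict_space lborel {0..T} \<Otimes>\<^sub>M M"
  have [measurable]: "f \<in> borel_measurable ?P" by (rule f)
  have "(\<integral>\<^sup>+z. ennreal ((f z)\<^sup>2) \<partial>?P) = (\<integral>\<^sup>+t. \<integral>\<^sup>+\<omega>. ennreal ((f (t, \<omega>))\<^sup>2) \<partial>M \<partial>?L)"
    by (subst nn_integral_fst) simp_all
  also have "\<dots> \<le> (\<integral>\<^sup>+t. ennreal C \<partial>?L)"
  proof (rule nn_integral_mono_AE)
    have "AE t in ?L. 0 < t \<and> t \<le> T"
      using AE_lborel_singleton[of "0::real"] by (auto simp: AE_restrict_space_iff)
    then show "AE t in ?L. (\<integral>\<^sup>+\<omega>. ennreal ((f (t, \<omega>))\<^sup>2) \<partial>M) \<le> ennreal C"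
    proof eventually_elim
      case (elim t)
      then have "(\<integral>\<^sup>+\<omega>. ennreal ((f (t, \<omega>))\<^sup>2) \<partial>M) = ennreal (\<integral>\<omega>. (f (t, \<omega>))\<^sup>2 \<partial>M)"
        using sq[of t] by (intro nn_integral_eq_integral) (auto simp: square_integrable_def)
      then show ?case using le[of t] elim by (simp add: ennreal_leI)
    qed
  qed
  also have "\<dots> = ennreal (C * T)"
    using assms(2,3) by (simp add: emeasure_restrict_space space_restrict_space ennreal_mult)
  finally have fin: "(\<integral>\<^sup>+z. ennreal ((f z)\<^sup>2) \<partial>?P) \<le> ennreal (C * T)" .
  have int: "integrable ?P (\<lambda>z. (f z)\<^sup>2)"
    using fin by (intro integrableI_nonneg) (auto simp: le_less_trans[OF _ ennreal_less_top])
  then show "square_integrable ?P f" by (simp add: square_integrable_def)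
  have "ennreal (\<integral>z. (f z)\<^sup>2 \<partial>?P) \<le> ennreal (C * T)"
    using fin nn_integral_eq_integral[OF int] by simp
  then show "(\<integral>z. (f z)\<^sup>2 \<partial>?P) \<le> C * T"
    using assms(2,3) by (simp add: ennreal_le_iff)
qed

lemma uniform_grid_cell:
  fixes t d :: real
  assumes "0 < d" "0 < t" "t \<le> real N * d"
  obtains i where "i < N" "real i * d < t" "t \<le> real (Suc i) * d"
proof -
  define i where "i = nat \<lceil>t / d\<rceil> - 1"
  have "0 < t / d" using assms by simp
  then have "int (Suc i) = \<lceil>t / d\<rceil>" by (simp add: i_def)
  then have Suc_i: "real (Suc i) = real_of_int \<lceil>t / d\<rceil>" by (metis of_int_of_nat_eq)
  have "t / d \<le> real (Suc i)" unfolding Suc_i by (rule le_of_int_ceiling)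
  then have upper: "t \<le> real (Suc i) * d"
    using assms(1) by (simp only: pos_divide_le_eq)
  have "real i < t / d"
    using ceiling_correct[of "t / d"] Suc_i by simp
  then have lower: "real i * d < t"
    using assms(1) by (simp only: pos_less_divide_eq)
  with assms(3) have "real i * d < real N * d" by linarith
  then have "i < N" using assms(1) by simp
  then show thesis using lower upper by (rule that)
qed

lemma elementary_process_uniform_grid:
  assumes "0 < d" "i < N" "real i * d < t" "t \<le> real (Suc i) * d"
  shows "elementary_process N (\<lambda>i. real i * d) e t \<omega> = e i \<omega>"
proof -
  have ind: "indicator {real j * d<..real (Suc j) * d} t = (if j = i then 1 else 0 :: real)" for j
  proof (cases "real j * d < t \<and> t \<le> real (Suc j) * d")
    case True
    with assms have "real j * d < real (Suc i) * d" "real i * d < real (Suc j) * d"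
      by linarith+
    then have "j < Suc i" "i < Suc j"
      unfolding mult_less_cancel_right_pos[OF assms(1)] of_nat_less_iff .
    then have "j = i" by simp
    with True show ?thesis by (simp only: greaterThanAtMost_iff indicator_simps simp_thms if_True)
  next
    case False
    with assms(3,4) have "j \<noteq> i" by metis
    with False show ?thesis by (simp only: greaterThanAtMost_iff indicator_simps if_False not_False_eq_True)
  qed
  have "elementary_process N (\<lambda>i. real i * d) e t \<omega> = (\<Sum>j<N. if j = i then e j \<omega> else 0)"
    unfolding elementary_process_def ind by (intro sum.cong refl) simp
  also have "\<dots> = e i \<omega>" using assms(2) by simp
  finally show ?thesis .
qed

lemma natural_filtration_measurable:
  assumes "0 \<le> s" "s \<le> t"
  shows "W s \<in> borel_measurable (natural_filtration M W t)"
proof (rule measurableI)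
  fix A :: "real set" assume "A \<in> sets borel"
  then have "W s -` A \<inter> space M \<in> sigma_sets (space M)
      {W s -` A \<inter> space M |s A. s \<in> {0..t} \<and> A \<in> sets borel}"
    using assms by (intro sigma_sets.Basic) auto
  moreover have "{W s -` A \<inter> space M |s A. s \<in> {0..t} \<and> A \<in> sets borel} \<subseteq> Pow (space M)"
    by auto
  ultimately show "W s -` A \<inter> space (natural_filtration M W t) \<in> sets (natural_filtration M W t)"
    unfolding natural_filtration_def by simp
qed simp

lemma brownian_poly_square_integrable_start:
  assumes "brownian_motion M x W" "0 \<le> t"
  shows "square_integrable M (\<lambda>\<omega>. poly p (W t \<omega> - x))"
proof (rule square_integrable_cong_AE[OF brownian_poly_square_integrable[OF assms, of p]])
  show "(\<lambda>\<omega>. poly p (W t \<omega> - x)) \<in> borel_measurable M"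
    using brownian_measurable[OF assms] by measurable
  show "AE \<omega> in M. poly p (W t \<omega> - W 0 \<omega>) = poly p (W t \<omega> - x)"
    using brownian_start[OF assms(1)] by eventually_elim simp
qed

lemma integral_square_AE_scaled:
  assumes X: "square_integrable M X" and Y: "Y \<in> borel_measurable M"
    and eq: "AE \<omega> in M. Y \<omega> = c * X \<omega>" and le: "(\<integral>\<omega>. (X \<omega>)\<^sup>2 \<partial>M) \<le> C"
  shows "square_integrable M Y" "(\<integral>\<omega>. (Y \<omega>)\<^sup>2 \<partial>M) \<le> c\<^sup>2 * C"
proof -
  have eq': "AE \<omega> in M. c * X \<omega> = Y \<omega>" using eq by eventually_elim simp
  show sq: "square_integrable M Y"
    by (rule square_integrable_cong_AE[OF square_integrable_cmult[OF X] Y eq'])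
  have "AE \<omega> in M. (Y \<omega>)\<^sup>2 = c\<^sup>2 * (X \<omega>)\<^sup>2"
    using eq by eventually_elim (simp add: power_mult_distrib)
  then have "(\<integral>\<omega>. (Y \<omega>)\<^sup>2 \<partial>M) = (\<integral>\<omega>. c\<^sup>2 * (X \<omega>)\<^sup>2 \<partial>M)"
    using X sq by (intro integral_cong_AE) (auto simp: square_integrable_def)
  then show "(\<integral>\<omega>. (Y \<omega>)\<^sup>2 \<partial>M) \<le> c\<^sup>2 * C"
    using le by (simp add: mult_left_mono)
qed

text \<open>
  The integrands are frozen at the left ends of \<open>k + 1\<close> intervals of length \<open>d k = T / (k + 1)\<close>.  They
  differ from the process by remainders of order one, and their integrals from \<open>Z\<close> by the error
  \<open>R k (k + 1)\<close>; both second moments are \<open>O(d k)\<close>.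
\<close>
lemma has_ito_integral_hermite:
  assumes bm: "brownian_motion M x W" and T: "0 < T"
    and Z: "Z \<in> borel_measurable M" "AE \<omega> in M. Z \<omega> = c * poly (hermite (Suc n) T) (W T \<omega> - x)"
  shows "has_ito_integral M W T (\<lambda>s \<omega>. c * poly (hermite n s) (grid_limit W s \<omega> - x)) Z"
proof -
  interpret prob_space M by (rule brownian_prob_space[OF bm])
  let ?P = "restrict_space lborel {0..T} \<Otimes>\<^sub>M M"
  have W[measurable]: "W t \<in> borel_measurable M" if "0 \<le> t" for t
    by (rule brownian_measurable[OF bm that])
  \<comment> \<open>\<open>e\<close> uses \<open>W\<close> itself, which is adapted, while \<open>H\<close> uses its jointly measurable version\<close>
  define H where "H = (\<lambda>(s, \<omega>). c * poly (hermite n s) (grid_limit W s \<omega> - x))"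
  define d where "d k = T / real (Suc k)" for k
  define \<tau> where "\<tau> k i = real i * d k" for k i
  define e where "e k i \<omega> = c * poly (hermite n (\<tau> k i)) (W (\<tau> k i) \<omega> - x)" for k i \<omega>
  have d: "0 < d k" "real (Suc k) * d k = T" for k
    using T by (simp_all add: d_def)
  have \<tau>: "0 \<le> \<tau> k i" "\<tau> k i \<le> \<tau> k (Suc i)" for k i
    using d(1)[of k] by (simp_all add: \<tau>_def)
  have \<tau>_le: "\<tau> k i \<le> T" if "i \<le> Suc k" for k i
    using that d(1)[of k] unfolding \<tau>_def d(2)[of k, symmetric] by (intro mult_right_mono) simp_all
  have e_sq: "square_integrable M (e k i)" for k i
    unfolding e_def[abs_def] by (intro square_integrable_cmult brownian_poly_square_integrable_start[OF bm] \<tau>)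
  have elem: "elementary_integrand M W T (Suc k) (\<tau> k) (e k)" for k
    unfolding elementary_integrand_def
  proof (intro conjI allI impI e_sq)
    show "e k i \<in> borel_measurable (natural_filtration M W (\<tau> k i))" for i
    proof -
      have [measurable]: "W (\<tau> k i) \<in> borel_measurable (natural_filtration M W (\<tau> k i))"
        by (rule natural_filtration_measurable[OF \<tau>(1) order_refl])
      show ?thesis unfolding e_def[abs_def] by measurable
    qed
  qed (use \<tau> \<tau>_le in auto)
  have H_borel: "H \<in> borel_measurable ?P"
  proof -
    have "(\<lambda>t. t) \<in> measurable (restrict_space lborel {0..T}) borel"
      by (intro measurable_restrict_space1) simp
    then have [measurable]: "(\<lambda>z. fst z) \<in> borel_measurable ?P"
      by (rule measurable_compose[OF measurable_fst])
    have "(\<lambda>z. (fst z, snd z)) \<in> measurable ?P (borel \<Otimes>\<^sub>M M)" by measurable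
    from measurable_compose[OF this grid_limit_measurable[OF W]]
    have [measurable]: "(\<lambda>z. grid_limit W (fst z) (snd z)) \<in> borel_measurable ?P" by simp
    have "(\<lambda>z. (fst z, grid_limit W (fst z) (snd z) - x)) \<in> measurable ?P (borel \<Otimes>\<^sub>M borel)" by measurable
    from measurable_compose[OF this hermite_measurable[of n]]
    show ?thesis by (simp add: H_def case_prod_beta')
  qed
  have H_sec: "(\<lambda>\<omega>. H (t, \<omega>)) \<in> borel_measurable M" for t
    using grid_limit_measurable_section[of W M t, OF W] by (simp add: H_def)
  have H_eq: "AE \<omega> in M. H (t, \<omega>) = c * poly (hermite n t) (W t \<omega> - W 0 \<omega>)" if "0 \<le> t" for t
    using brownian_grid_limit_AE[OF bm that] brownian_start[OF bm]
    by eventually_elim (simp add: H_def)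
  have H_bound: "square_integrable M (\<lambda>\<omega>. H (t, \<omega>))" "(\<integral>\<omega>. (H (t, \<omega>))\<^sup>2 \<partial>M) \<le> c\<^sup>2 * T ^ n"
    if "0 < t" "t \<le> T" for t
  proof -
    have "t ^ n / fact n \<le> t ^ n" using that by (simp add: divide_le_eq mult_le_cancel_left1)
    also have "\<dots> \<le> T ^ n" using that by (intro power_mono) auto
    finally have "(\<integral>\<omega>. (poly (hermite n t) (W t \<omega> - W 0 \<omega>))\<^sup>2 \<partial>M) \<le> T ^ n"
      using brownian_hermite_orthogonal[OF bm, of t n n] that by (simp add: power2_eq_square)
    with that show "square_integrable M (\<lambda>\<omega>. H (t, \<omega>))" "(\<integral>\<omega>. (H (t, \<omega>))\<^sup>2 \<partial>M) \<le> c\<^sup>2 * T ^ n"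
      by (intro integral_square_AE_scaled[OF _ H_sec H_eq] brownian_poly_square_integrable[OF bm]; simp)+
  qed
  have H_sq: "square_integrable ?P H"
    using T by (intro product_square_integrable_bound(1)[OF prob_space_axioms _ _ H_borel H_bound]) auto
  define G where "G k = (\<lambda>(t, \<omega>). elementary_process (Suc k) (\<tau> k) (e k) t \<omega>)" for k
  have G_borel: "G k \<in> borel_measurable ?P" for k
  proof -
    have [measurable]: "e k i \<in> borel_measurable M" for i
      using e_sq[of k i] by (simp add: square_integrable_def)
    have "(\<lambda>t. t) \<in> measurable (restrict_space lborel {0..T}) borel"
      by (intro measurable_restrict_space1) simp
    then have [measurable]: "(\<lambda>z. fst z) \<in> borel_measurable ?P"
      by (rule measurable_compose[OF measurable_fst])
    show ?thesis unfolding G_def elementary_process_def case_prod_beta' by measurable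
  qed
  define C where "C k = c\<^sup>2 * (real (Suc n) * T ^ (n - 1) * d k)" for k
  have C: "0 \<le> C k" for k using T d(1)[of k] by (simp add: C_def)
  have diff: "square_integrable M (\<lambda>\<omega>. G k (t, \<omega>) - H (t, \<omega>))"
    "(\<integral>\<omega>. (G k (t, \<omega>) - H (t, \<omega>))\<^sup>2 \<partial>M) \<le> C k" if t: "0 < t" "t \<le> T" for k t
  proof -
    obtain i where i: "i < Suc k" "real i * d k < t" "t \<le> real (Suc i) * d k"
      using uniform_grid_cell[OF d(1)[of k] t(1), of "Suc k"] t d(2)[of k] by auto
    define s where "s = \<tau> k i"
    have s: "0 \<le> s" "s < t" "t - s \<le> d k"
      using i \<tau>(1)[of k i] by (simp_all add: s_def \<tau>_def algebra_simps)
    have G: "G k (t, \<omega>) = c * poly (hermite n s) (W s \<omega> - x)" for \<omega>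
      using elementary_process_uniform_grid[OF d(1)[of k] i, of "e k" \<omega>]
      by (simp add: G_def e_def s_def \<tau>_def[abs_def])
    define D where "D \<omega> = (\<Sum>j\<in>{1..n}. poly (hermite (n - j) s) (W s \<omega> - W 0 \<omega>) *
        poly (hermite j (t - s)) (W t \<omega> - W s \<omega>))" for \<omega>
    have split: "poly (hermite n t) (W t \<omega> - W 0 \<omega>) = poly (hermite n s) (W s \<omega> - W 0 \<omega>) + D \<omega>" for \<omega>
    proof -
      have "poly (hermite n t) (W t \<omega> - W 0 \<omega>) =
        poly (hermite n (s + (t - s))) ((W s \<omega> - W 0 \<omega>) + (W t \<omega> - W s \<omega>))" by simp
      also have "\<dots> = (\<Sum>j\<in>{..n}. poly (hermite (n - j) s) (W s \<omega> - W 0 \<omega>) *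
        poly (hermite j (t - s)) (W t \<omega> - W s \<omega>))"
        by (rule hermite_add)
      also have "{..n} = insert 0 {1..n}" by auto
      finally show ?thesis by (simp add: D_def)
    qed
    have D_sq: "square_integrable M D"
      unfolding D_def[abs_def] by (rule hermite_increment_square(1)[OF bm s(1,2)])
    have D_le: "(\<integral>\<omega>. (D \<omega>)\<^sup>2 \<partial>M) \<le> real (Suc n) * T ^ (n - 1) * d k"
    proof -
      have "(\<integral>\<omega>. (D \<omega>)\<^sup>2 \<partial>M) \<le> real (Suc n) * T ^ (n - 1) * (t - s) ^ 1"
        unfolding D_def by (rule hermite_increment_square_le[OF bm s(1,2) t(2)])
      also have "\<dots> \<le> real (Suc n) * T ^ (n - 1) * d k"
        using s T by (intro mult_left_mono) auto
      finally show ?thesis .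
    qed
    have meas: "(\<lambda>\<omega>. G k (t, \<omega>) - H (t, \<omega>)) \<in> borel_measurable M"
      unfolding G using W[OF s(1)] H_sec[of t] by measurable
    have eq: "AE \<omega> in M. G k (t, \<omega>) - H (t, \<omega>) = (- c) * D \<omega>"
      using H_eq[OF less_imp_le[OF t(1)]] brownian_start[OF bm]
    proof eventually_elim
      case (elim \<omega>)
      then show ?case using split[of \<omega>] by (simp add: G algebra_simps)
    qed
    show "square_integrable M (\<lambda>\<omega>. G k (t, \<omega>) - H (t, \<omega>))"
      by (rule integral_square_AE_scaled(1)[OF D_sq meas eq D_le])
    show "(\<integral>\<omega>. (G k (t, \<omega>) - H (t, \<omega>))\<^sup>2 \<partial>M) \<le> C k"
      using integral_square_AE_scaled(2)[OF D_sq meas eq D_le] by (simp add: C_def)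
  qed
  have GH: "square_integrable ?P (\<lambda>z. G k z - H z)" "(\<integral>z. (G k z - H z)\<^sup>2 \<partial>?P) \<le> C k * T" for k
    using product_square_integrable_bound[OF prob_space_axioms less_imp_le[OF T] C
        borel_measurable_diff[OF G_borel H_borel] diff] by auto
  have G_sq: "square_integrable ?P (G k)" for k
    using square_integrable_add[OF GH(1) H_sq, of k] by simp
  have d0: "d \<longlonglongrightarrow> 0"
    unfolding d_def[abs_def] using LIMSEQ_Suc[OF lim_const_over_n[of T]] by simp
  have conv1: "L2_tendsto ?P G H"
  proof (rule L2_tendstoI_bound[OF G_sq H_sq GH(2)])
    show "(\<lambda>k. C k * T) \<longlonglongrightarrow> 0"
      unfolding C_def using d0 by (intro tendsto_mult_left_zero tendsto_mult_right_zero)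
  qed
  define R where "R k m \<omega> = poly (hermite (Suc n) (real m * d k)) (W (real m * d k) \<omega> - W 0 \<omega>) -
      (\<Sum>i<m. poly (hermite n (real i * d k)) (W (real i * d k) \<omega> - W 0 \<omega>) *
         (W (real (Suc i) * d k) \<omega> - W (real i * d k) \<omega>))" for k m \<omega>
  have I_borel: "elementary_integral W (Suc k) (\<tau> k) (e k) \<in> borel_measurable M" for k
    unfolding elementary_integral_def[abs_def]
    using e_sq[unfolded square_integrable_def] W[OF \<tau>(1)]
    by (intro borel_measurable_sum borel_measurable_times borel_measurable_diff) auto
  have I_eq: "AE \<omega> in M. elementary_integral W (Suc k) (\<tau> k) (e k) \<omega> - Z \<omega> = (- c) * R k (Suc k) \<omega>" for k
    using Z(2) brownian_start[OF bm]
  proof eventually_elim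
    case (elim \<omega>)
    have "elementary_integral W (Suc k) (\<tau> k) (e k) \<omega> =
        c * (\<Sum>i<Suc k. poly (hermite n (real i * d k)) (W (real i * d k) \<omega> - W 0 \<omega>) *
         (W (real (Suc i) * d k) \<omega> - W (real i * d k) \<omega>))"
      unfolding elementary_integral_def e_def \<tau>_def elim sum_distrib_left by (simp only: mult.assoc)
    then show ?case unfolding R_def elim d(2) by (simp add: algebra_simps)
  qed
  note R_bound = hermite_riemann_error[OF bm d(1) R_def]
  have IZ: "square_integrable M (\<lambda>\<omega>. elementary_integral W (Suc k) (\<tau> k) (e k) \<omega> - Z \<omega>)"
    "(\<integral>\<omega>. (elementary_integral W (Suc k) (\<tau> k) (e k) \<omega> - Z \<omega>)\<^sup>2 \<partial>M) \<le>
      c\<^sup>2 * (real (n + 2) * T ^ (n - 1) * T * d k)" for k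
  proof -
    have "(\<integral>\<omega>. (R k (Suc k) \<omega>)\<^sup>2 \<partial>M) \<le>
        real (Suc k) * (real (n + 2) * (real (Suc k) * d k) ^ (n - 1) * (d k)\<^sup>2)"
      by (rule conjunct2[OF R_bound])
    also have "\<dots> = real (n + 2) * (real (Suc k) * d k) ^ (n - 1) * (real (Suc k) * d k) * d k"
      by (simp only: power2_eq_square mult_ac)
    finally have le: "(\<integral>\<omega>. (R k (Suc k) \<omega>)\<^sup>2 \<partial>M) \<le> real (n + 2) * T ^ (n - 1) * T * d k"
      unfolding d(2) .
    have "(\<lambda>\<omega>. elementary_integral W (Suc k) (\<tau> k) (e k) \<omega> - Z \<omega>) \<in> borel_measurable M"
      by (intro borel_measurable_diff I_borel Z)
    note scaled = integral_square_AE_scaled[OF conjunct1[OF R_bound] this I_eq le]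
    show "square_integrable M (\<lambda>\<omega>. elementary_integral W (Suc k) (\<tau> k) (e k) \<omega> - Z \<omega>)"
      by (rule scaled(1))
    show "(\<integral>\<omega>. (elementary_integral W (Suc k) (\<tau> k) (e k) \<omega> - Z \<omega>)\<^sup>2 \<partial>M) \<le>
      c\<^sup>2 * (real (n + 2) * T ^ (n - 1) * T * d k)"
      by (rule scaled(2)[unfolded power2_minus])
  qed
  have Z_sq: "square_integrable M Z"
    using T by (intro square_integrable_cong_AE[OF square_integrable_cmult[OF
          brownian_poly_square_integrable_start[OF bm, of T "hermite (Suc n) T"], of c] Z(1)])
       (use Z(2) in \<open>auto elim!: eventually_mono\<close>)
  have I_sq: "square_integrable M (elementary_integral W (Suc k) (\<tau> k) (e k))" for k
    using square_integrable_add[OF IZ(1) Z_sq, of k] by simp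
  have conv2: "L2_tendsto M (\<lambda>k. elementary_integral W (Suc k) (\<tau> k) (e k)) Z"
  proof (rule L2_tendstoI_bound[OF I_sq Z_sq IZ(2)])
    show "(\<lambda>k. c\<^sup>2 * (real (n + 2) * T ^ (n - 1) * T * d k)) \<longlonglongrightarrow> 0"
      using d0 by (intro tendsto_mult_right_zero)
  qed
  show ?thesis
    unfolding has_ito_integral_def
    using elem conv1 conv2 unfolding G_def H_def by (intro exI[of _ "\<lambda>k. Suc k"] exI[of _ \<tau>] exI[of _ e]) simp
qed

text \<open>
  The positive horizon excludes only the null set \<open>{0}\<close> of times in the inner integrals.
\<close>
lemma has_iterated_ito_integral_const:
  assumes bm: "brownian_motion M x W"
  shows "0 < T \<Longrightarrow> Z \<in> borel_measurable M \<Longrightarrow> AE \<omega> in M. Z \<omega> = c * poly (hermite n T) (W T \<omega> - x) \<Longrightarrow>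
    has_iterated_ito_integral M W n T (\<lambda>_. c) Z"
proof (induction n arbitrary: T Z)
  case 0
  then show ?case by simp
next
  case (Suc n)
  define Y where "Y s \<omega> = c * poly (hermite n s) (grid_limit W s \<omega> - x)" for s \<omega>
  have [measurable]: "grid_limit W s \<in> borel_measurable M" for s
    by (rule grid_limit_measurable_section) (rule brownian_measurable[OF bm])
  have "AE s in restrict_space lborel {0..T}. 0 < s"
    using AE_lborel_singleton[of "0::real"] by (auto simp: AE_restrict_space_iff)
  then have "AE s in restrict_space lborel {0..T}. has_iterated_ito_integral M W n s (\<lambda>_. c) (Y s)"
  proof eventually_elim
    case (elim s)
    show ?case
    proof (rule Suc.IH[OF elim])
      show "Y s \<in> borel_measurable M" unfolding Y_def[abs_def] by measurable
      show "AE \<omega> in M. Y s \<omega> = c * poly (hermite n s) (W s \<omega> - x)"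
        using brownian_grid_limit_AE[OF bm less_imp_le[OF elim]]
        by eventually_elim (simp add: Y_def)
    qed
  qed
  moreover have "has_ito_integral M W T Y Z"
    unfolding Y_def by (rule has_ito_integral_hermite[OF bm Suc.prems])
  ultimately show ?case by auto
qed

section \<open>Polynomial approximation of the indicator in Gaussian L2\<close>

text \<open>
  The Taylor polynomial of \<open>Si\<close>, obtained by dividing that of \<open>sin\<close> by its variable and integrating.
  The term \<open>i = 0\<close> is \<open>0\<close> since \<open>sin_coeff 0 = 0\<close>.
\<close>
definition Si_poly :: "nat \<Rightarrow> real poly" where
  "Si_poly m = (\<Sum>i<m. monom (sin_coeff i / real i) i)"

lemma poly_Si_poly: "poly (Si_poly m) z = (\<Sum>i<m. sin_coeff i / real i * z ^ i)"
  by (simp add: Si_poly_def poly_sum poly_monom)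

lemma Si_0: "Si 0 = 0"
  using Si_neg[of 0] by simp

text \<open>
  The mean value theorem transfers the Taylor bound for \<open>sin\<close> to the derivative of \<open>Si\<close> and from
  there to \<open>Si\<close>.
\<close>
lemma Si_poly_approx: "\<bar>Si z - poly (Si_poly (Suc m)) z\<bar> \<le> \<bar>z\<bar> ^ Suc m / fact (Suc m)"
proof -
  define f where "f z = Si z - poly (Si_poly (Suc m)) z" for z
  define f' where "f' z = sinc z - (\<Sum>i<Suc m. sin_coeff i / real i * (real i * z ^ (i - 1)))" for z
  have f0: "f 0 = 0" by (simp add: f_def Si_0 poly_Si_poly zero_power sum.lessThan_Suc_shift)
  have deriv: "(f has_real_derivative f' z) (at z)" for z
    unfolding f_def f'_def poly_Si_poly
    by (rule derivative_eq_intros DERIV_Si refl | simp add: mult.commute)+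
  have bound: "\<bar>f' \<xi>\<bar> \<le> \<bar>z\<bar> ^ m / fact (Suc m)" if "\<xi> \<noteq> 0" "\<bar>\<xi>\<bar> \<le> \<bar>z\<bar>" for \<xi> z
  proof -
    have "\<xi> * f' \<xi> = sin \<xi> - (\<Sum>i<Suc m. sin_coeff i * \<xi> ^ i)"
    proof -
      have "\<xi> * (sin_coeff i / real i * (real i * \<xi> ^ (i - 1))) = sin_coeff i * \<xi> ^ i" for i
        by (cases i) simp_all
      then show ?thesis using that(1) by (simp only: f'_def right_diff_distrib sum_distrib_left) simp
    qed
    then have "\<bar>\<xi>\<bar> * \<bar>f' \<xi>\<bar> \<le> inverse (fact (Suc m)) * \<bar>\<xi>\<bar> ^ Suc m"
      using Maclaurin_sin_bound[of \<xi> "Suc m"] by (simp only: abs_mult[symmetric])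
    then have "\<bar>\<xi>\<bar> * \<bar>f' \<xi>\<bar> \<le> \<bar>\<xi>\<bar> * (\<bar>\<xi>\<bar> ^ m / fact (Suc m))"
      by (simp only: power_Suc divide_inverse mult_ac)
    then have "\<bar>f' \<xi>\<bar> \<le> \<bar>\<xi>\<bar> ^ m / fact (Suc m)"
      by (rule mult_left_le_imp_le) (use that(1) in simp)
    also have "\<dots> \<le> \<bar>z\<bar> ^ m / fact (Suc m)"
      using that(2) by (intro divide_right_mono power_mono) simp_all
    finally show ?thesis .
  qed
  have "\<bar>f z\<bar> \<le> \<bar>z\<bar> * (\<bar>z\<bar> ^ m / fact (Suc m))"
  proof (cases z "0 :: real" rule: linorder_cases)
    case less
    obtain \<xi> where "z < \<xi>" "\<xi> < 0" "f 0 - f z = (0 - z) * f' \<xi>"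
      using MVT2[OF less, of f f'] deriv by blast
    then have "\<bar>f z\<bar> = \<bar>z\<bar> * \<bar>f' \<xi>\<bar>" "\<bar>f' \<xi>\<bar> \<le> \<bar>z\<bar> ^ m / fact (Suc m)"
      using bound[of \<xi> z] f0 by (simp_all add: abs_mult)
    then show ?thesis by (simp only: mult_left_mono abs_ge_zero)
  next
    case equal
    then show ?thesis by (simp add: f0)
  next
    case greater
    obtain \<xi> where "0 < \<xi>" "\<xi> < z" "f z - f 0 = (z - 0) * f' \<xi>"
      using MVT2[OF greater, of f f'] deriv by blast
    then have "\<bar>f z\<bar> = \<bar>z\<bar> * \<bar>f' \<xi>\<bar>" "\<bar>f' \<xi>\<bar> \<le> \<bar>z\<bar> ^ m / fact (Suc m)"
      using bound[of \<xi> z] f0 by (simp_all add: abs_mult)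
    then show ?thesis by (simp only: mult_left_mono abs_ge_zero)
  qed
  then show ?thesis by (simp add: f_def)
qed

lemma power_div_fact_le_exp:
  fixes z :: real
  assumes "0 \<le> z"
  shows "z ^ n / fact n \<le> exp z"
proof -
  have s: "(\<lambda>n. z ^ n /\<^sub>R fact n) sums exp z" by (rule exp_converges)
  have "z ^ n /\<^sub>R fact n \<le> (\<Sum>k. z ^ k /\<^sub>R fact k)"
    using sum_le_suminf[OF sums_summable[OF s], of "{n}"] assms by simp
  then show ?thesis using sums_unique[OF s] by (simp add: field_simps)
qed

text \<open>
  Completing the square turns \<open>exp (b y)\<close> times the kernel into a multiple of a shifted normal
  density.
\<close>
lemma gauss_integrable_exp:
  assumes "0 < t"
  shows "integrable lborel (\<lambda>y. gauss_kernel t y * exp (B * \<bar>y\<bar>))"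
proof -
  have shift: "gauss_kernel t y * exp (b * y) = exp (b\<^sup>2 * t / 2) * normal_density (b * t) (sqrt t) y" for b y
  proof -
    have "- y\<^sup>2 / (2 * t) + b * y = b\<^sup>2 * t / 2 + - (y - b * t)\<^sup>2 / (2 * t)"
      using assms by (simp add: field_simps power2_eq_square)
    then have "exp (- y\<^sup>2 / (2 * t)) * exp (b * y) = exp (b\<^sup>2 * t / 2) * exp (- (y - b * t)\<^sup>2 / (2 * t))"
      by (simp only: exp_add[symmetric])
    then show ?thesis using assms by (simp add: gauss_kernel_def normal_density_def)
  qed
  have int: "integrable lborel (\<lambda>y. gauss_kernel t y * exp (b * y))" for b
    unfolding shift using assms by (intro integrable_mult_right integrable_normal_density) simp
  show ?thesis
  proof (rule Bochner_Integration.integrable_bound)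
    show "integrable lborel (\<lambda>y. gauss_kernel t y * exp (B * y) + gauss_kernel t y * exp (- B * y))"
      by (intro Bochner_Integration.integrable_add int)
    have "gauss_kernel t y * exp (B * \<bar>y\<bar>) \<le>
        gauss_kernel t y * exp (B * y) + gauss_kernel t y * exp (- B * y)" for y
      unfolding distrib_left[symmetric]
      by (intro mult_left_mono gauss_kernel_nonneg[OF assms]) (simp add: abs_if)
    then show "AE y in lborel. norm (gauss_kernel t y * exp (B * \<bar>y\<bar>)) \<le>
        norm (gauss_kernel t y * exp (B * y) + gauss_kernel t y * exp (- B * y))"
      using gauss_kernel_nonneg[OF assms] by (intro AE_I2) (simp add: abs_mult)
  qed simp
qed

text \<open>
  By \<open>Si_poly_approx\<close> the error at \<open>z = k (y - a)\<close> is at most \<open>\<bar>z\<bar>\<^sup>m\<^sup>+\<^sup>1 / (m + 1)!\<close>.  This tends to \<open>0\<close>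
  and is bounded by \<open>exp \<bar>z\<bar>\<close>, whose square is integrable with respect to the kernel: dominated
  convergence applies.
\<close>
lemma Si_poly_gauss_L2:
  assumes t: "0 < t"
  shows "(\<lambda>m. \<integral>y. gauss_kernel t y *
    (Si (k * (y - a)) - poly (pcompose (Si_poly (Suc m)) [:- k * a, k:]) y)\<^sup>2 \<partial>lborel) \<longlonglongrightarrow> 0"
    and "integrable lborel (\<lambda>y. gauss_kernel t y *
    (Si (k * (y - a)) - poly (pcompose (Si_poly (Suc m)) [:- k * a, k:]) y)\<^sup>2)"
proof -
  define s where "s m y = gauss_kernel t y *
    (Si (k * (y - a)) - poly (pcompose (Si_poly (Suc m)) [:- k * a, k:]) y)\<^sup>2" for m y
  define w where "w y = exp (2 * \<bar>k\<bar> * \<bar>a\<bar>) * (gauss_kernel t y * exp (2 * \<bar>k\<bar> * \<bar>y\<bar>))" for y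
  have [measurable]: "s m \<in> borel_measurable lborel" for m
    unfolding s_def by measurable
  have err: "s m y \<le> gauss_kernel t y * (\<bar>k * (y - a)\<bar> ^ Suc m / fact (Suc m))\<^sup>2" for m y
  proof -
    have "poly (pcompose (Si_poly (Suc m)) [:- k * a, k:]) y = poly (Si_poly (Suc m)) (k * (y - a))"
      by (simp add: poly_pcompose algebra_simps)
    then show ?thesis
      using Si_poly_approx[of "k * (y - a)" m] gauss_kernel_nonneg[OF t, of y]
      unfolding s_def by (metis abs_ge_zero mult_left_mono power2_abs power_mono)
  qed
  have s_nonneg: "0 \<le> s m y" for m y
    using gauss_kernel_nonneg[OF t, of y] by (simp add: s_def)
  have dom: "norm (s m y) \<le> w y" for m y
  proof -
    have "(\<bar>k * (y - a)\<bar> ^ Suc m / fact (Suc m))\<^sup>2 \<le> (exp \<bar>k * (y - a)\<bar>)\<^sup>2"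
      by (intro power_mono power_div_fact_le_exp) simp_all
    also have "\<dots> = exp (2 * \<bar>k * (y - a)\<bar>)" by (simp add: exp_double)
    also have "\<dots> \<le> exp (2 * \<bar>k\<bar> * \<bar>a\<bar> + 2 * \<bar>k\<bar> * \<bar>y\<bar>)"
    proof -
      have "\<bar>k * (y - a)\<bar> \<le> \<bar>k\<bar> * (\<bar>y\<bar> + \<bar>a\<bar>)"
        unfolding abs_mult by (intro mult_left_mono abs_triangle_ineq4) simp
      then show ?thesis unfolding exp_le_cancel_iff distrib_left by linarith
    qed
    finally have "gauss_kernel t y * (\<bar>k * (y - a)\<bar> ^ Suc m / fact (Suc m))\<^sup>2 \<le> w y"
      using gauss_kernel_nonneg[OF t, of y] by (simp add: w_def exp_add mult_left_mono mult_ac)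
    then show ?thesis using err[of m y] s_nonneg[of m y] by simp
  qed
  have w: "integrable lborel w"
    unfolding w_def by (intro integrable_mult_right gauss_integrable_exp t)
  have lim: "(\<lambda>m. s m y) \<longlonglongrightarrow> 0" for y
  proof (rule tendsto_sandwich[OF _ _ tendsto_const])
    have "(\<lambda>n. \<bar>k * (y - a)\<bar> ^ n / fact n) \<longlonglongrightarrow> 0"
      using summable_LIMSEQ_zero[OF summable_exp[of "\<bar>k * (y - a)\<bar>"]] by (simp add: field_simps)
    then have "(\<lambda>m. \<bar>k * (y - a)\<bar> ^ Suc m / fact (Suc m)) \<longlonglongrightarrow> 0" by (rule LIMSEQ_Suc)
    then show "(\<lambda>m. gauss_kernel t y * (\<bar>k * (y - a)\<bar> ^ Suc m / fact (Suc m))\<^sup>2) \<longlonglongrightarrow> 0"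
      by (intro tendsto_mult_right_zero tendsto_null_power) simp_all
  qed (intro always_eventually allI err s_nonneg)+
  have "(\<lambda>m. \<integral>y. s m y \<partial>lborel) \<longlonglongrightarrow> (\<integral>y. 0 \<partial>(lborel :: real measure))"
    by (rule integral_dominated_convergence[where w = w]) (auto simp: w lim intro!: AE_I2 dom[unfolded real_norm_def])
  then show "(\<lambda>m. \<integral>y. gauss_kernel t y *
    (Si (k * (y - a)) - poly (pcompose (Si_poly (Suc m)) [:- k * a, k:]) y)\<^sup>2 \<partial>lborel) \<longlonglongrightarrow> 0"
    by (simp add: s_def)
  have "integrable lborel (s m)"
    by (intro Bochner_Integration.integrable_bound[OF w] AE_I2)
       (auto intro: order_trans[OF dom[unfolded real_norm_def] abs_ge_self])
  then show "integrable lborel (\<lambda>y. gauss_kernel t y *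
    (Si (k * (y - a)) - poly (pcompose (Si_poly (Suc m)) [:- k * a, k:]) y)\<^sup>2)"
    by (simp add: s_def[abs_def])
qed

text \<open>
  \<open>Si\<close> is bounded, odd, and tends to \<open>\<pi> / 2\<close>, so dominated convergence applies.  Convergence
  fails only at the single point \<open>y = a\<close>.
\<close>
lemma Si_indicator_gauss_L2:
  assumes t: "0 < t"
  shows "(\<lambda>k. \<integral>y. gauss_kernel t y *
    (indicator {a..} y - (1 / 2 + Si (real k * (y - a)) / pi))\<^sup>2 \<partial>lborel) \<longlonglongrightarrow> 0"
    and "integrable lborel (\<lambda>y. gauss_kernel t y *
    (indicator {a..} y - (1 / 2 + Si (real k * (y - a)) / pi))\<^sup>2)"
proof -
  define s where "s k y = gauss_kernel t y *
    (indicator {a..} y - (1 / 2 + Si (real k * (y - a)) / pi))\<^sup>2" for k y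
  obtain B where B: "\<And>z. \<bar>Si z\<bar> \<le> B" using bounded_Si by blast
  define w where "w y = (3 / 2 + B / pi)\<^sup>2 * gauss_kernel t y" for y
  have [measurable]: "s k \<in> borel_measurable lborel" for k
    unfolding s_def by measurable
  have dom: "norm (s k y) \<le> w y" for k y
  proof -
    define q where "q = Si (real k * (y - a)) / pi"
    have "\<bar>q\<bar> \<le> B / pi"
      using B by (simp add: q_def divide_right_mono)
    then have "\<bar>indicator {a..} y - (1 / 2 + q)\<bar> \<le> 3 / 2 + B / pi"
      unfolding abs_le_iff by (auto simp: indicator_def)
    then have "\<bar>indicator {a..} y - (1 / 2 + Si (real k * (y - a)) / pi)\<bar> \<le> 3 / 2 + B / pi"
      unfolding q_def .
    then have "(indicator {a..} y - (1 / 2 + Si (real k * (y - a)) / pi))\<^sup>2 \<le> (3 / 2 + B / pi)\<^sup>2"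
      by (metis abs_ge_zero power2_abs power_mono)
    then show ?thesis
      using gauss_kernel_nonneg[OF t, of y] by (simp add: s_def w_def mult_left_mono mult.commute)
  qed
  have w: "integrable lborel w"
    unfolding w_def gauss_kernel_eq_normal_density[OF t]
    using t by (intro integrable_mult_right integrable_normal_density) simp
  have lim: "(\<lambda>k. s k y) \<longlonglongrightarrow> 0" if "y \<noteq> a" for y
  proof -
    have "(\<lambda>k. Si (real k * (y - a))) \<longlonglongrightarrow> pi * (indicator {a..} y - 1 / 2)"
    proof (cases "y > a")
      case True
      then have "filterlim (\<lambda>k. real k * (y - a)) at_top sequentially" by real_asymp
      from filterlim_compose[OF Si_at_top this] True show ?thesis by simp
    next
      case False
      with that have "filterlim (\<lambda>k. real k * (a - y)) at_top sequentially" by real_asymp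
      from tendsto_minus[OF filterlim_compose[OF Si_at_top this]]
      have "(\<lambda>k. - Si (real k * (a - y))) \<longlonglongrightarrow> - (pi / 2)" .
      moreover have "- Si (real k * (a - y)) = Si (real k * (y - a))" for k
      proof -
        have "Si (- (real k * (a - y))) = - Si (real k * (a - y))"
          using False by (intro Si_neg) simp
        then show ?thesis by (simp add: algebra_simps)
      qed
      ultimately show ?thesis using False that by simp
    qed
    then have "(\<lambda>k. s k y) \<longlonglongrightarrow> gauss_kernel t y *
        (indicator {a..} y - (1 / 2 + pi * (indicator {a..} y - 1 / 2) / pi))\<^sup>2"
      unfolding s_def by (intro tendsto_intros) simp_all
    then show ?thesis by simp
  qed
  have "AE y in lborel. y \<noteq> a" by (rule AE_lborel_singleton)
  then have "AE y in lborel. (\<lambda>k. s k y) \<longlonglongrightarrow> 0" by eventually_elim (rule lim)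
  then have "(\<lambda>k. \<integral>y. s k y \<partial>lborel) \<longlonglongrightarrow> (\<integral>y. 0 \<partial>(lborel :: real measure))"
    by (intro integral_dominated_convergence[where w = w])
       (auto simp: w intro!: AE_I2 dom[unfolded real_norm_def])
  then show "(\<lambda>k. \<integral>y. gauss_kernel t y *
    (indicator {a..} y - (1 / 2 + Si (real k * (y - a)) / pi))\<^sup>2 \<partial>lborel) \<longlonglongrightarrow> 0"
    by (simp add: s_def)
  have "integrable lborel (s k)"
    by (intro Bochner_Integration.integrable_bound[OF w] AE_I2)
       (auto intro: order_trans[OF dom[unfolded real_norm_def] abs_ge_self])
  then show "integrable lborel (\<lambda>y. gauss_kernel t y *
    (indicator {a..} y - (1 / 2 + Si (real k * (y - a)) / pi))\<^sup>2)"
    by (simp add: s_def[abs_def])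
qed

lemma poly_approx_indicator_gauss_L2:
  assumes t: "0 < t" and "0 < \<epsilon>"
  shows "\<exists>p. (\<integral>y. gauss_kernel t y * (indicator {a..} y - poly p y)\<^sup>2 \<partial>lborel) < \<epsilon>"
proof -
  obtain k :: nat where k: "(\<integral>y. gauss_kernel t y *
      (indicator {a..} y - (1 / 2 + Si (real k * (y - a)) / pi))\<^sup>2 \<partial>lborel) < \<epsilon> / 4"
    using order_tendstoD(2)[OF Si_indicator_gauss_L2(1)[OF t], of "\<epsilon> / 4" a] assms(2)
    by (auto simp: eventually_sequentially)
  obtain m where m: "(\<integral>y. gauss_kernel t y *
    (Si (real k * (y - a)) - poly (pcompose (Si_poly (Suc m)) [:- real k * a, real k:]) y)\<^sup>2 \<partial>lborel) < \<epsilon> / 4"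
    using order_tendstoD(2)[OF Si_poly_gauss_L2(1)[OF t], of "\<epsilon> / 4" "real k" a] assms(2)
    by (auto simp: eventually_sequentially)
  define q where "q = pcompose (Si_poly (Suc m)) [:- real k * a, real k:]"
  define p where "p = [:1 / 2:] + smult (1 / pi) q"
  define u where "u y = indicator {a..} y - (1 / 2 + Si (real k * (y - a)) / pi)" for y :: real
  define v where "v y = Si (real k * (y - a)) - poly q y" for y
  have int: "integrable lborel (\<lambda>y. gauss_kernel t y * (u y)\<^sup>2)" "integrable lborel (\<lambda>y. gauss_kernel t y * (v y)\<^sup>2)"
    unfolding u_def v_def q_def by (rule Si_indicator_gauss_L2(2)[OF t] Si_poly_gauss_L2(2)[OF t])+
  have le: "(indicator {a..} y - poly p y)\<^sup>2 \<le> 2 * (u y)\<^sup>2 + 2 * (v y)\<^sup>2" for y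
  proof -
    have "indicator {a..} y - poly p y = u y + v y / pi"
      by (simp add: u_def v_def p_def field_simps)
    moreover have "(u y + v y / pi)\<^sup>2 \<le> 2 * (u y)\<^sup>2 + 2 * (v y / pi)\<^sup>2"
      using zero_le_power2[of "u y - v y / pi"] by (simp add: power2_sum power2_diff)
    moreover have "(v y / pi)\<^sup>2 \<le> (v y)\<^sup>2"
    proof -
      have "(v y)\<^sup>2 / pi\<^sup>2 \<le> (v y)\<^sup>2 / 1"
        using pi_ge_two by (intro divide_left_mono one_le_power) simp_all
      then show ?thesis by (simp add: power_divide)
    qed
    ultimately show ?thesis by simp
  qed
  have "(\<integral>y. gauss_kernel t y * (indicator {a..} y - poly p y)\<^sup>2 \<partial>lborel) \<le>
      (\<integral>y. 2 * (gauss_kernel t y * (u y)\<^sup>2) + 2 * (gauss_kernel t y * (v y)\<^sup>2) \<partial>lborel)"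
  proof (rule integral_mono')
    show "integrable lborel (\<lambda>y. 2 * (gauss_kernel t y * (u y)\<^sup>2) + 2 * (gauss_kernel t y * (v y)\<^sup>2))"
      using int by simp
    show "gauss_kernel t y * (indicator {a..} y - poly p y)\<^sup>2 \<le>
        2 * (gauss_kernel t y * (u y)\<^sup>2) + 2 * (gauss_kernel t y * (v y)\<^sup>2)" for y
      using mult_left_mono[OF le gauss_kernel_nonneg[OF t], of y y] by (simp add: algebra_simps)
    show "0 \<le> 2 * (gauss_kernel t y * (u y)\<^sup>2) + 2 * (gauss_kernel t y * (v y)\<^sup>2)" for y
      using gauss_kernel_nonneg[OF t, of y] by simp
  qed
  also have "\<dots> = 2 * (\<integral>y. gauss_kernel t y * (u y)\<^sup>2 \<partial>lborel) + 2 * (\<integral>y. gauss_kernel t y * (v y)\<^sup>2 \<partial>lborel)"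
    using int by simp
  also have "\<dots> < \<epsilon>"
    using k m by (simp add: u_def v_def q_def)
  finally show ?thesis by blast
qed

section \<open>The chaos expansion\<close>

text \<open>
  The partial sum of the Hermite expansion is the orthogonal projection of \<open>F\<close> onto the polynomials
  of degree below \<open>N\<close> in \<open>X\<close>, hence the best approximation among them.
\<close>
lemma hermite_projection_error_le:
  assumes t: "0 < t" and X: "distributed M lborel X (\<lambda>y. ennreal (gauss_kernel t y))"
    and F: "square_integrable M F"
    and c: "\<And>n. c n = fact n / t ^ n * (\<integral>\<omega>. F \<omega> * poly (hermite n t) (X \<omega>) \<partial>M)"
    and p: "degree p < N"
  shows "(\<integral>\<omega>. ((\<Sum>n<N. c n * poly (hermite n t) (X \<omega>)) - F \<omega>)\<^sup>2 \<partial>M) \<le>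
    (\<integral>\<omega>. (F \<omega> - poly p (X \<omega>))\<^sup>2 \<partial>M)"
proof -
  define h where "h n \<omega> = poly (hermite n t) (X \<omega>)" for n \<omega>
  have [measurable]: "X \<in> borel_measurable M" using distributed_measurable[OF X] by simp
  have h: "square_integrable M (h n)" for n
    unfolding square_integrable_def h_def[abs_def]
    using poly_distributed_gauss[OF t X, of "(hermite n t)\<^sup>2"] by simp
  obtain b where b: "\<And>y. poly p y = (\<Sum>n<N. b n * poly (hermite n t) y)"
    using poly_eq_sum_hermite[OF p] by metis
  define U where "U \<omega> = (\<Sum>n<N. c n * h n \<omega>) - F \<omega>" for \<omega>
  define V where "V \<omega> = (\<Sum>n<N. (b n - c n) * h n \<omega>)" for \<omega>
  have U: "square_integrable M U"
    unfolding U_def[abs_def] by (intro square_integrable_diff square_integrable_sum square_integrable_cmult h F)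
  have V: "square_integrable M V"
    unfolding V_def[abs_def] by (intro square_integrable_sum square_integrable_cmult h)
  have Uh: "(\<integral>\<omega>. U \<omega> * h n \<omega> \<partial>M) = 0" if "n < N" for n
  proof -
    have "(\<integral>\<omega>. U \<omega> * h n \<omega> \<partial>M) = (\<integral>\<omega>. (\<Sum>m<N. c m * (h m \<omega> * h n \<omega>)) - F \<omega> * h n \<omega> \<partial>M)"
      by (simp add: U_def left_diff_distrib sum_distrib_right mult.assoc)
    also have "\<dots> = (\<Sum>m<N. c m * (\<integral>\<omega>. h m \<omega> * h n \<omega> \<partial>M)) - (\<integral>\<omega>. F \<omega> * h n \<omega> \<partial>M)"
      using square_integrable_mult[OF h h] square_integrable_mult[OF F h]
      by (subst Bochner_Integration.integral_diff) (auto simp: Bochner_Integration.integral_sum)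
    also have "(\<Sum>m<N. c m * (\<integral>\<omega>. h m \<omega> * h n \<omega> \<partial>M)) = c n * (t ^ n / fact n)"
      using that by (simp add: h_def hermite_distributed_gauss[OF t X] if_distrib sum.delta cong: if_cong)
    also have "\<dots> - (\<integral>\<omega>. F \<omega> * h n \<omega> \<partial>M) = 0"
      using t by (simp add: c h_def)
    finally show ?thesis .
  qed
  have "(\<integral>\<omega>. U \<omega> * V \<omega> \<partial>M) = (\<integral>\<omega>. (\<Sum>n<N. (b n - c n) * (U \<omega> * h n \<omega>)) \<partial>M)"
    by (simp add: V_def sum_distrib_left mult_ac)
  also have "\<dots> = (\<Sum>n<N. (b n - c n) * (\<integral>\<omega>. U \<omega> * h n \<omega> \<partial>M))"
    using square_integrable_mult[OF U h] by (subst Bochner_Integration.integral_sum) auto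
  finally have UV: "(\<integral>\<omega>. U \<omega> * V \<omega> \<partial>M) = 0" using Uh by simp
  have "(F \<omega> - poly p (X \<omega>))\<^sup>2 = (U \<omega>)\<^sup>2 + (V \<omega>)\<^sup>2 + 2 * (U \<omega> * V \<omega>)" for \<omega>
  proof -
    have "F \<omega> - poly p (X \<omega>) = - (U \<omega> + V \<omega>)"
      by (simp add: U_def V_def b h_def left_diff_distrib sum_subtractf)
    then show ?thesis by (simp only: power2_minus power2_sum mult.assoc)
  qed
  then have "(\<integral>\<omega>. (F \<omega> - poly p (X \<omega>))\<^sup>2 \<partial>M) = (\<integral>\<omega>. (U \<omega>)\<^sup>2 \<partial>M) + (\<integral>\<omega>. (V \<omega>)\<^sup>2 \<partial>M)"
    using U V square_integrable_mult[OF U V] UV by (simp add: square_integrable_def)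
  moreover have "0 \<le> (\<integral>\<omega>. (V \<omega>)\<^sup>2 \<partial>M)" by simp
  ultimately show ?thesis by (simp add: U_def h_def)
qed

lemma time_simplex_sets: "time_simplex n T \<in> sets (\<Pi>\<^sub>M i\<in>{1..n}. lborel)"
proof -
  let ?P = "\<Pi>\<^sub>M i\<in>{1..n}. (lborel :: real measure)"
  have comp: "(\<lambda>t. t i) \<in> borel_measurable ?P" if "i \<in> {1..n}" for i
    using measurable_component_singleton[OF that, of "\<lambda>_. lborel :: real measure"] by simp
  have "{t \<in> space ?P. i \<le> j \<longrightarrow> t i \<le> t j} \<in> sets ?P" if "i \<in> {1..n}" "j \<in> {1..n}" for i j
    using borel_measurable_le[OF comp comp, OF that] by (cases "i \<le> j") simp_all
  then have mono: "{t \<in> space ?P. \<forall>i\<in>{1..n}. \<forall>j\<in>{1..n}. i \<le> j \<longrightarrow> t i \<le> t j} \<in> sets ?P"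
    by (rule sets.sets_Collect_finite_All[OF sets.sets_Collect_finite_All]) simp_all
  have box: "({1..n} \<rightarrow>\<^sub>E {0..T}) \<in> sets ?P"
    by (intro sets_PiM_I_finite) simp_all
  have "time_simplex n T = ({1..n} \<rightarrow>\<^sub>E {0..T}) \<inter>
      {t \<in> space ?P. \<forall>i\<in>{1..n}. \<forall>j\<in>{1..n}. i \<le> j \<longrightarrow> t i \<le> t j}"
    using sets.sets_into_space[OF box] unfolding time_simplex_def mono_on_def by blast
  also have "\<dots> \<in> sets ?P" using box mono by (rule sets.Int)
  finally show ?thesis .
qed

text \<open>
  The simplex has finite volume because it lies in a cube.
\<close>
lemma L2_kernel_const: "L2_kernel n T (\<lambda>_. c)"
proof -
  interpret product_sigma_finite "\<lambda>_::nat. lborel :: real measure" ..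
  let ?P = "\<Pi>\<^sub>M i\<in>{1..n}. (lborel :: real measure)"
  have sets: "time_simplex n T \<inter> space ?P \<in> sets ?P" using time_simplex_sets by auto
  have "emeasure ?P (time_simplex n T) \<le> emeasure ?P ({1..n} \<rightarrow>\<^sub>E {0..T})"
    by (intro emeasure_mono sets_PiM_I_finite) (auto simp: time_simplex_def)
  also have "\<dots> = (\<Prod>i\<in>{1..n}. emeasure lborel {0..T})" by (rule emeasure_PiM) auto
  also have "\<dots> < \<infinity>" by (simp add: ennreal_power less_top[symmetric] power_eq_top_ennreal emeasure_lborel_Icc_eq)
  finally have fin: "emeasure ?P (time_simplex n T) < \<infinity>" .
  have "finite_measure (restrict_space ?P (time_simplex n T))"
  proof (rule finite_measureI)
    have "space (restrict_space ?P (time_simplex n T)) = time_simplex n T"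
      using sets.sets_into_space[OF time_simplex_sets] by (auto simp: space_restrict_space)
    then show "emeasure (restrict_space ?P (time_simplex n T)) (space (restrict_space ?P (time_simplex n T))) \<noteq> \<infinity>"
      using fin emeasure_restrict_space[OF sets] by simp
  qed
  then show ?thesis
    by (simp add: L2_kernel_def square_integrable_def finite_measure.integrable_const)
qed

lemma brownian_distributed:
  assumes bm: "brownian_motion M x W" and t: "0 < t"
  shows "distributed M lborel (\<lambda>\<omega>. W t \<omega> - x) (\<lambda>y. ennreal (gauss_kernel t y))"
proof -
  have [measurable]: "W t \<in> borel_measurable M" "W 0 \<in> borel_measurable M"
    using t by (auto intro: brownian_measurable[OF bm])
  have D: "distributed M lborel (\<lambda>\<omega>. W t \<omega> - W 0 \<omega>) (\<lambda>y. ennreal (gauss_kernel t y))"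
    using brownian_increment_distributed[OF bm order_refl t] by simp
  have "AE \<omega> in M. W t \<omega> - x = W t \<omega> - W 0 \<omega>"
    using brownian_start[OF bm] by eventually_elim simp
  then have "distr M lborel (\<lambda>\<omega>. W t \<omega> - x) = distr M lborel (\<lambda>\<omega>. W t \<omega> - W 0 \<omega>)"
    by (intro distr_cong_AE) simp_all
  with D show ?thesis by (simp add: distributed_def)
qed

theorem corollary3p1:
  fixes M :: "'a measure" and W :: "real \<Rightarrow> 'a \<Rightarrow> real" and T K x :: real
    and F :: "'a \<Rightarrow> real"
  assumes "T > 0"
    and "brownian_motion M x W"
    and "F = (\<lambda>\<omega>. indicator {K..} (W T \<omega>))"
  shows "\<exists>g :: nat \<Rightarrow> (nat \<Rightarrow> real) \<Rightarrow> real.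
    has_chaos_expansion M W T F g \<and>
    g 0 (\<lambda>_. undefined) = (\<integral>\<omega>. F \<omega> \<partial>M) \<and>
    (\<integral>\<omega>. F \<omega> \<partial>M) = measure M {\<omega> \<in> space M. W T \<omega> > K} \<and>
    (\<forall>n\<ge>1. \<forall>t \<in> {1..n} \<rightarrow>\<^sub>E {0<..<T}. mono_on {1..n} t \<longrightarrow>
       g n t = gauss_kernel_deriv (n - 1) T (x - K))"
proof -
  note T = assms(1) and bm = assms(2)
  interpret prob_space M by (rule brownian_prob_space[OF bm])
  have [measurable]: "W T \<in> borel_measurable M"
    using T by (intro brownian_measurable[OF bm]) simp
  define X where "X \<omega> = W T \<omega> - x" for \<omega>
  define a where "a = K - x"
  have [measurable]: "X \<in> borel_measurable M" unfolding X_def[abs_def] by measurable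
  have X: "distributed M lborel X (\<lambda>y. ennreal (gauss_kernel T y))"
    unfolding X_def[abs_def] by (rule brownian_distributed[OF bm T])
  note expect = distributed_integral[OF X _ gauss_kernel_nonneg[OF T], symmetric]
  have F: "F \<omega> = indicator {a..} (X \<omega>)" for \<omega>
    by (simp add: assms(3) a_def X_def indicator_def)
  have F_sq: "square_integrable M F"
    unfolding square_integrable_def F by (auto intro!: integrable_const_bound[of _ 1] split: split_indicator)
  define c where "c n = fact n / T ^ n * (\<integral>\<omega>. F \<omega> * poly (hermite n T) (X \<omega>) \<partial>M)" for n
  define Z where "Z n \<omega> = c n * poly (hermite n T) (W T \<omega> - x)" for n \<omega>
  have Z[measurable]: "Z n \<in> borel_measurable M" for n
    unfolding Z_def[abs_def] by measurable
  have c0: "c 0 = (\<integral>\<omega>. F \<omega> \<partial>M)" by (simp add: c_def)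
  have c_Suc: "c (Suc n) = gauss_kernel_deriv n T (x - K)" for n
  proof -
    have coeff: "(\<integral>\<omega>. F \<omega> * poly (hermite (Suc n) T) (X \<omega>) \<partial>M) =
        T / real (n + 1) * (poly (hermite n T) a * gauss_kernel T a)"
      unfolding F gauss_integral_hermite_half_line[OF T, symmetric] by (subst expect) simp_all
    have "c (Suc n) = fact n / T ^ n * (poly (hermite n T) a * gauss_kernel T a)"
    proof -
      have cancel: "(r * f) / (T * P) * (T / r * Y) = f / P * Y" if "r \<noteq> 0" "P \<noteq> 0" for r f P Y :: real
        using that T by (simp add: field_simps)
      show ?thesis
        unfolding c_def coeff Suc_eq_plus1[symmetric] unfolding fact_Suc power_Suc
        using T by (intro cancel) simp_all
    qed
    \<comment> \<open>the two signs \<open>(-1)\<^sup>n\<close>, from the Rodrigues formula and from the parity of \<open>hermite n T\<close>, cancel\<close>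
    also have "\<dots> = gauss_kernel_deriv n T (- a)"
      by (simp add: rodrigues_hermite[OF T] hermite_minus gauss_kernel_minus)
    finally show ?thesis by (simp add: a_def)
  qed
  have Z_sq: "square_integrable M (\<lambda>\<omega>. \<Sum>n<N. Z n \<omega>)" for N
    unfolding Z_def
    using T by (intro square_integrable_sum square_integrable_cmult brownian_poly_square_integrable_start[OF bm]) simp
  have "(\<lambda>N. \<integral>\<omega>. ((\<Sum>n<N. Z n \<omega>) - F \<omega>)\<^sup>2 \<partial>M) \<longlonglongrightarrow> 0"
  proof (rule LIMSEQ_I)
    fix \<epsilon> :: real assume "0 < \<epsilon>"
    then obtain p where p: "(\<integral>y. gauss_kernel T y * (indicator {a..} y - poly p y)\<^sup>2 \<partial>lborel) < \<epsilon>"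
      using poly_approx_indicator_gauss_L2[OF T] by blast
    have "norm ((\<integral>\<omega>. ((\<Sum>n<N. Z n \<omega>) - F \<omega>)\<^sup>2 \<partial>M) - 0) < \<epsilon>" if "N \<ge> Suc (degree p)" for N
    proof -
      have "(\<integral>\<omega>. ((\<Sum>n<N. Z n \<omega>) - F \<omega>)\<^sup>2 \<partial>M) \<le> (\<integral>\<omega>. (F \<omega> - poly p (X \<omega>))\<^sup>2 \<partial>M)"
        unfolding Z_def X_def[symmetric]
        by (rule hermite_projection_error_le[OF T X F_sq c_def]) (use that in simp)
      also have "\<dots> < \<epsilon>"
        using p unfolding F by (subst expect) simp_all
      finally show ?thesis by simp
    qed
    then show "\<exists>N0. \<forall>N\<ge>N0. norm ((\<integral>\<omega>. ((\<Sum>n<N. Z n \<omega>) - F \<omega>)\<^sup>2 \<partial>M) - 0) < \<epsilon>" by blast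
  qed
  then have conv: "L2_tendsto M (\<lambda>N \<omega>. \<Sum>n<N. Z n \<omega>) F"
    using Z_sq F_sq by (simp add: L2_tendsto_def)
  have iter: "has_iterated_ito_integral M W n T (\<lambda>_. c n) (Z n)" for n
    by (rule has_iterated_ito_integral_const[OF bm T Z]) (simp add: Z_def)
  have chaos: "has_chaos_expansion M W T F (\<lambda>n _. c n)"
    unfolding has_chaos_expansion_def using L2_kernel_const iter conv by blast
  have EF: "(\<integral>\<omega>. F \<omega> \<partial>M) = measure M {\<omega> \<in> space M. W T \<omega> > K}"
  proof -
    have "(\<integral>\<omega>. F \<omega> \<partial>M) = (\<integral>y. gauss_kernel T y * indicator {a..} y \<partial>lborel)"
      unfolding F by (subst expect) simp_all
    \<comment> \<open>the law of \<open>W T\<close> has no atom at \<open>K\<close>\<close>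
    also have "\<dots> = (\<integral>y. gauss_kernel T y * indicator {a<..} y \<partial>lborel)"
      using AE_lborel_singleton[of a] by (intro integral_cong_AE) (auto split: split_indicator)
    also have "\<dots> = (\<integral>\<omega>. indicator {a<..} (X \<omega>) \<partial>M)"
      by (subst expect) simp_all
    also have "\<dots> = (\<integral>\<omega>. indicator {\<omega> \<in> space M. W T \<omega> > K} \<omega> \<partial>M)"
      by (intro Bochner_Integration.integral_cong) (auto simp: X_def a_def indicator_def)
    also have "\<dots> = measure M {\<omega> \<in> space M. W T \<omega> > K}" by simp
    finally show ?thesis .
  qed
  have "c n = gauss_kernel_deriv (n - 1) T (x - K)" if "n \<ge> 1" for n
    using c_Suc[of "n - 1"] that by simp
  with chaos EF c0 show ?thesis by (intro exI[of _ "\<lambda>n _. c n"]) simp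
qed

end
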